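(* Let $\alpha\in(1,2)$ and $\varepsilon\in(0,1)$ be fixed, and consider the random graph model M3 with parameter $\alpha$ on $n$ nodes. Let $q_c>0$, $q_l>0$, $|r|\le q_c$ be fixed with $2q_c+q_l\le 1$, let $d=d(\alpha)$, and let $P$ be the transition matrix of the homogeneous Markov chain with parameters $q_c,q_l,r,d$ on a random graph from M3. (1) If $r=0$ (the reversible homogeneous chain), then there are constants $c_1,c_2>0$ not depending on $n$ such that asymptotically almost surely as $n\to\infty$ $$c_1 n^{2\alpha-2}\log^2 n < t_{\rm mix}(P,\varepsilon) < c_2\, d(\alpha)^2\, n^{2\alpha-2}\log^3 n .$$ (2) If $r\neq0$ (non-reversible homogeneous chain) and the chain is lazy asymptotically almost surely, then there are constants $c_1,c_2>0$ not depending on $n$ such that asymptotically almost surely as $n\to\infty$ $$c_1 n^{\alpha-1}\log n < t_{\rm mix}(P,\varepsilon) < c_2\, d(\alpha)^2\, n^{2\alpha-2}\log^3 n .$$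
   Context: Mixing time: for a Markov chain with transition matrix $P$ on a finite set $\mathcal X$ with unique stationary distribution $\pi$, $t_{\rm mix}(P,\varepsilon)=\max_{\sigma}\min\{k:\|\sigma P^k-\pi\|_{\rm TV}\le\varepsilon\}$, the maximum being over probability distributions $\sigma$ on $\mathcal X$, where $\|\mu-\nu\|_{\rm TV}=\max_{A\subseteq\mathcal X}|\mu(A)-\nu(A)|$. A chain is lazy if $p_{ii}\ge 1/2$ for all states $i$. Model M3: start with the cycle on the nodes $0,1,\dots,n-1$ (node $i$ adjacent to $i\pm1$ mod $n$). Each of the $\binom n2$ pairs of distinct nodes is independently, with probability $2n^{-\alpha}$, added as an edge, called a long range edge. Pairs that are edges of the cycle are allowed to be chosen as long range edges. Homogeneous chain with parameters $q_c,q_l,r,d$: every clockwise transition along the cycle has probability $q_c+r$, every counterclockwise transition along the cycle has probability $q_c-r$, each long range edge is used (in each direction) with probability $q_l/d$, and with the remaining probability the chain stays put. If a long range edge coincides with a cycle edge, the probabilities add up. Its stationary distribution is uniform. $d(\alpha)$ denotes a fixed constant, depending only on $\alpha$, such that asymptotically almost surely no node of the random graph has more than $d(\alpha)$ long range edges (such a constant exists; with $d=d(\alpha)$ and $2q_c+q_l\le1$ the homogeneous chain is a proper Markov chain asymptotically almost surely). "Asymptotically almost surely" means with probability tending to 1 as $n\to\infty$. Constants may depend on the fixed parameters $\alpha,\varepsilon,q_c,q_l,r$ but not on $n$. *)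

theory Defs
  imports
    "HOL-Probability.Probability"
    "HOL-Library.Extended_Real"
    "Jordan_Normal_Form.Matrix"
begin

unbundle no vec_syntax

section \<open>Mixing times of finite chains\<close>

definition prob_vecs :: "nat \<Rightarrow> real vec set" where
  "prob_vecs n = {\<sigma> \<in> carrier_vec n. (\<forall>i<n. 0 \<le> \<sigma> $ i) \<and> (\<Sum>i<n. \<sigma> $ i) = 1}"

text \<open>Distributions are row vectors, so one step is \<open>\<sigma> P\<close>, that is, the transposed matrix applied
  to \<open>\<sigma>\<close>.\<close>

definition evolve :: "real mat \<Rightarrow> nat \<Rightarrow> real vec \<Rightarrow> real vec" where
  "evolve P k \<sigma> = transpose_mat (P ^\<^sub>m k) *\<^sub>v \<sigma>"

definition tv_dist :: "real vec \<Rightarrow> real vec \<Rightarrow> real" where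
  "tv_dist \<mu> \<nu> = Max ((\<lambda>A. \<bar>(\<Sum>i\<in>A. \<mu> $ i) - (\<Sum>i\<in>A. \<nu> $ i)\<bar>) ` Pow {..<dim_vec \<mu>})"

text \<open>Meaningful only for chains with a unique stationary distribution.\<close>

definition stationary_dist :: "real mat \<Rightarrow> real vec" where
  "stationary_dist P = (THE \<pi>. \<pi> \<in> prob_vecs (dim_row P) \<and> evolve P 1 \<pi> = \<pi>)"

text \<open>The value is \<open>\<infinity>\<close> if some start distribution never gets \<open>\<epsilon>\<close>-close (infimum of the empty set) or
  if the times needed are unbounded; otherwise the supremum and the infimum are attained.\<close>

definition t_mix :: "real mat \<Rightarrow> real \<Rightarrow> enat" where
  "t_mix P \<epsilon> =
     (SUP \<sigma> \<in> prob_vecs (dim_row P).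
        INF k \<in> {k. tv_dist (evolve P k \<sigma>) (stationary_dist P) \<le> \<epsilon>}. enat k)"

definition lazy_chain :: "real mat \<Rightarrow> bool" where
  "lazy_chain P \<longleftrightarrow> (\<forall>i<dim_row P. 1 / 2 \<le> P $$ (i, i))"

section \<open>The random graph model M3\<close>

definition node_pairs :: "nat \<Rightarrow> nat set set" where
  "node_pairs n = {e. e \<subseteq> {..<n} \<and> card e = 2}"

text \<open>A graph of the model is represented by its set of long range edges; the cycle is implicit.
  \<^const>\<open>bernoulli_pmf\<close> truncates its parameter to the unit interval, but since \<open>2 n\<^sup>-\<^sup>\<alpha> \<le> 1\<close> for
  \<open>\<alpha> \<ge> 1\<close> and \<open>n \<ge> 2\<close>, this is irrelevant for \<open>\<alpha> \<in> (1,2)\<close>.\<close>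

definition M3 :: "real \<Rightarrow> nat \<Rightarrow> nat set set pmf" where
  "M3 \<alpha> n =
     map_pmf (\<lambda>f. {e \<in> node_pairs n. f e})
       (Pi_pmf (node_pairs n) False (\<lambda>_. bernoulli_pmf (2 * real n powr (- \<alpha>))))"

definition M3_aas :: "real \<Rightarrow> (nat \<Rightarrow> nat set set \<Rightarrow> bool) \<Rightarrow> bool" where
  "M3_aas \<alpha> Q \<longleftrightarrow> (\<lambda>n. measure_pmf.prob (M3 \<alpha> n) {L. Q n L}) \<longlonglongrightarrow> 1"

definition long_degree :: "nat set set \<Rightarrow> nat \<Rightarrow> nat" where
  "long_degree L i = card {e \<in> L. i \<in> e}"

definition aas_degree_bound :: "real \<Rightarrow> real \<Rightarrow> bool" where
  "aas_degree_bound \<alpha> d \<longleftrightarrow> M3_aas \<alpha> (\<lambda>n L. \<forall>i<n. real (long_degree L i) \<le> d)"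

section \<open>The homogeneous chain\<close>

definition hom_trans ::
    "nat \<Rightarrow> nat set set \<Rightarrow> real \<Rightarrow> real \<Rightarrow> real \<Rightarrow> real \<Rightarrow> nat \<Rightarrow> nat \<Rightarrow> real" where
  "hom_trans n L q\<^sub>c q\<^sub>l r d i j =
     (if j = (i + 1) mod n then q\<^sub>c + r else 0) +
     (if i = (j + 1) mod n then q\<^sub>c - r else 0) +
     (if {i, j} \<in> L then q\<^sub>l / d else 0)"

definition hom_chain ::
    "nat \<Rightarrow> nat set set \<Rightarrow> real \<Rightarrow> real \<Rightarrow> real \<Rightarrow> real \<Rightarrow> real mat" where
  "hom_chain n L q\<^sub>c q\<^sub>l r d =
     mat n n (\<lambda>(i, j).
       if i = j then 1 - (\<Sum>k\<in>{..<n} - {i}. hom_trans n L q\<^sub>c q\<^sub>l r d i k)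
       else hom_trans n L q\<^sub>c q\<^sub>l r d i j)"

end

(*
  Upper bounds. Cut the cycle into blocks of l ~ 32 n^(alpha-1) ln n nodes. By a union bound, a.a.s. every
  set U of blocks has a long range edge to every disjoint set V of blocks that contains at least an
  eighth of all blocks and all but 2|U| of them. This gives an isoperimetric inequality with constant
  of order 1/(d l), hence by Cheeger's argument a contraction of mean zero functions in l^2 with rate
  of order 1/(d l)^2: directly if the chain is lazy, because then the norm drops by at least half the
  Dirichlet form. The reversible chain need not be lazy, so eigenvalues near -1 must be excluded as
  well: a.a.s. every window of w nodes, w a constant, has a node without long range edges, which
  stays put with probability at least q_l.

  Lower bounds. By the second moment method there is a.a.s. a run of 2H+1 nodes without long range
  edges, H of order n^(alpha-1) ln n. Started in its middle x, the functions |i-x|^2 (if r = 0) and |i-x|,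
  both capped at distance H, grow by at most 1 per step in expectation.
*)
theory Submission
  imports Defs "HOL-Real_Asymp.Real_Asymp"
begin

section \<open>Cheeger's inequality\<close>

lemma coarea_bound:
  fixes \<Phi> :: real and W :: "'a \<Rightarrow> 'a \<Rightarrow> real" and h :: "'a \<Rightarrow> real"
  assumes fin: "finite X" and W: "\<And>i j. i \<in> X \<Longrightarrow> j \<in> X \<Longrightarrow> 0 \<le> W i j"
    and iso: "\<And>S. S \<subseteq> X \<Longrightarrow> 2 * card S \<le> card X \<Longrightarrow>
      2 * \<Phi> * card S \<le> (\<Sum>i\<in>X. \<Sum>j\<in>X. W i j * \<bar>of_bool (i \<in> S) - of_bool (j \<in> S)\<bar>)"
    and "\<And>i. i \<in> X \<Longrightarrow> 0 \<le> h i" and "2 * card {i\<in>X. 0 < h i} \<le> card X"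
  shows "2 * \<Phi> * (\<Sum>i\<in>X. h i) \<le> (\<Sum>i\<in>X. \<Sum>j\<in>X. W i j * \<bar>h i - h j\<bar>)"
  using assms(4,5)
proof (induction "card {i\<in>X. 0 < h i}" arbitrary: h rule: less_induct)
  case less
  define S where "S = {i\<in>X. 0 < h i}"
  have S: "S \<subseteq> X" "finite S" using fin by (auto simp: S_def)
  show ?case
  proof (cases "S = {}")
    case True
    then have "h i = 0" if "i \<in> X" for i using less.prems(1)[OF that] that by (force simp: S_def)
    then show ?thesis by simp
  next
    case False
    define m where "m = Min (h ` S)"
    have m_le: "m \<le> h i" if "i \<in> S" for i using that S by (simp add: m_def)
    have "m \<in> h ` S" unfolding m_def using False S by (intro Min_in) auto
    then obtain k where k: "k \<in> S" "h k = m" by auto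
    have "0 < m" using k by (auto simp: S_def)
    define h' where "h' i = h i - m * of_bool (i \<in> S)" for i
    have h'0: "0 \<le> h' i" if "i \<in> X" for i
      using m_le[of i] less.prems(1)[OF that] by (auto simp: h'_def)
    have sub: "{i\<in>X. 0 < h' i} \<subset> S"
      using k \<open>0 < m\<close> S by (auto simp: h'_def S_def split: if_splits)
    have IH: "2 * \<Phi> * (\<Sum>i\<in>X. h' i) \<le> (\<Sum>i\<in>X. \<Sum>j\<in>X. W i j * \<bar>h' i - h' j\<bar>)"
    proof (rule less.hyps)
      show "card {i\<in>X. 0 < h' i} < card {i\<in>X. 0 < h i}"
        using sub S by (simp add: S_def[symmetric] psubset_card_mono)
      then show "2 * card {i\<in>X. 0 < h' i} \<le> card X" using less.prems(2) by linarith
    qed (rule h'0)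
    have split: "\<bar>h i - h j\<bar> = \<bar>h' i - h' j\<bar> + m * \<bar>of_bool (i \<in> S) - of_bool (j \<in> S)\<bar>"
      if "i \<in> X" "j \<in> X" for i j
      using m_le[of i] m_le[of j] \<open>0 < m\<close> less.prems(1)[OF that(1)] less.prems(1)[OF that(2)] that
      by (auto simp: h'_def S_def)
    have "(\<Sum>i\<in>X. h i) = (\<Sum>i\<in>X. h' i) + m * card S"
      using S fin by (simp add: h'_def sum_subtractf sum_distrib_left[symmetric] Int_absorb1)
    then have "2 * \<Phi> * (\<Sum>i\<in>X. h i) = 2 * \<Phi> * (\<Sum>i\<in>X. h' i) + m * (2 * \<Phi> * card S)"
      by (simp add: algebra_simps)
    also have "\<dots> \<le> (\<Sum>i\<in>X. \<Sum>j\<in>X. W i j * \<bar>h' i - h' j\<bar>)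
        + m * (\<Sum>i\<in>X. \<Sum>j\<in>X. W i j * \<bar>of_bool (i \<in> S) - of_bool (j \<in> S)\<bar>)"
      using IH iso[OF S(1)] less.prems(2) \<open>0 < m\<close> by (intro add_mono mult_left_mono) (auto simp: S_def)
    also have "\<dots> = (\<Sum>i\<in>X. \<Sum>j\<in>X. W i j * \<bar>h i - h j\<bar>)"
      by (simp add: split sum_distrib_left sum.distrib[symmetric] algebra_simps cong: sum.cong)
    finally show ?thesis .
  qed
qed

lemma Cauchy_Schwarz_weighted:
  fixes w a b :: "'a \<Rightarrow> real"
  assumes "\<And>i. i \<in> X \<Longrightarrow> 0 \<le> w i"
  shows "(\<Sum>i\<in>X. w i * (a i * b i))\<^sup>2 \<le> (\<Sum>i\<in>X. w i * (a i)\<^sup>2) * (\<Sum>i\<in>X. w i * (b i)\<^sup>2)"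
proof -
  have "(\<Sum>i\<in>X. w i * (a i * b i)) = (\<Sum>i\<in>X. (sqrt (w i) * a i) * (sqrt (w i) * b i))"
    using assms by (intro sum.cong) (auto simp: algebra_simps)
  moreover have "(\<Sum>i\<in>X. w i * (c i)\<^sup>2) = (\<Sum>i\<in>X. (sqrt (w i) * c i)\<^sup>2)" for c
    using assms by (intro sum.cong) (auto simp: power_mult_distrib)
  ultimately show ?thesis
    using Cauchy_Schwarz_ineq_sum[of "\<lambda>i. sqrt (w i) * a i" "\<lambda>i. sqrt (w i) * b i" X] by simp
qed

lemma Cheeger_nonneg:
  fixes \<Phi> :: real and W :: "'a \<Rightarrow> 'a \<Rightarrow> real" and f :: "'a \<Rightarrow> real"
  assumes fin: "finite X" and W: "\<And>i j. i \<in> X \<Longrightarrow> j \<in> X \<Longrightarrow> 0 \<le> W i j"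
    and row: "\<And>i. i \<in> X \<Longrightarrow> (\<Sum>j\<in>X. W i j) = 1" and col: "\<And>j. j \<in> X \<Longrightarrow> (\<Sum>i\<in>X. W i j) = 1"
    and iso: "\<And>S. S \<subseteq> X \<Longrightarrow> 2 * card S \<le> card X \<Longrightarrow>
      2 * \<Phi> * card S \<le> (\<Sum>i\<in>X. \<Sum>j\<in>X. W i j * \<bar>of_bool (i \<in> S) - of_bool (j \<in> S)\<bar>)"
    and "0 \<le> \<Phi>"
    and f: "\<And>i. i \<in> X \<Longrightarrow> 0 \<le> f i" and supp: "2 * card {i\<in>X. 0 < f i} \<le> card X"
  shows "\<Phi>\<^sup>2 * (\<Sum>i\<in>X. (f i)\<^sup>2) \<le> (\<Sum>i\<in>X. \<Sum>j\<in>X. W i j * (f i - f j)\<^sup>2)"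
proof -
  define N where "N = (\<Sum>i\<in>X. (f i)\<^sup>2)"
  define E where "E = (\<Sum>i\<in>X. \<Sum>j\<in>X. W i j * (f i - f j)\<^sup>2)"
  have "{i\<in>X. 0 < (f i)\<^sup>2} = {i\<in>X. 0 < f i}" using f by force
  then have "2 * \<Phi> * N \<le> (\<Sum>i\<in>X. \<Sum>j\<in>X. W i j * \<bar>(f i)\<^sup>2 - (f j)\<^sup>2\<bar>)"
    unfolding N_def using supp by (intro coarea_bound[OF fin W iso]) auto
  also have "\<dots> = (\<Sum>(i,j)\<in>X\<times>X. W i j * (\<bar>f i - f j\<bar> * (f i + f j)))"
  proof -
    have "\<bar>(f i)\<^sup>2 - (f j)\<^sup>2\<bar> = \<bar>f i - f j\<bar> * (f i + f j)" if "i \<in> X" "j \<in> X" for i j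
      using f[OF that(1)] f[OF that(2)]
      by (simp add: power2_eq_square square_diff_square_factored abs_mult mult.commute)
    then show ?thesis unfolding sum.cartesian_product by (intro sum.cong) auto
  qed
  finally have 1: "2 * \<Phi> * N \<le> \<dots>" .
  have N0: "0 \<le> N" and E0: "0 \<le> E" unfolding N_def E_def using W by (auto intro!: sum_nonneg)
  have r: "(\<Sum>i\<in>X. \<Sum>j\<in>X. W i j * (f i)\<^sup>2) = N"
    by (simp add: N_def sum_distrib_right[symmetric] row)
  have c: "(\<Sum>i\<in>X. \<Sum>j\<in>X. W i j * (f j)\<^sup>2) = N"
    unfolding N_def by (subst sum.swap) (simp add: sum_distrib_right[symmetric] col)
  have "(\<Sum>i\<in>X. \<Sum>j\<in>X. W i j * (f i + f j)\<^sup>2)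
     \<le> (\<Sum>i\<in>X. \<Sum>j\<in>X. 2 * (W i j * (f i)\<^sup>2) + 2 * (W i j * (f j)\<^sup>2))"
  proof (intro sum_mono)
    fix i j assume "i \<in> X" "j \<in> X"
    have "(f i + f j)\<^sup>2 \<le> 2 * (f i)\<^sup>2 + 2 * (f j)\<^sup>2"
      using zero_le_power2[of "f i - f j"] by (simp add: power2_eq_square algebra_simps)
    from mult_left_mono[OF this W[OF \<open>i \<in> X\<close> \<open>j \<in> X\<close>]]
    show "W i j * (f i + f j)\<^sup>2 \<le> 2 * (W i j * (f i)\<^sup>2) + 2 * (W i j * (f j)\<^sup>2)"
      by (simp add: algebra_simps)
  qed
  also have "\<dots> = 4 * N" by (simp add: sum.distrib sum_distrib_left[symmetric] r c)
  finally have 2: "(\<Sum>i\<in>X. \<Sum>j\<in>X. W i j * (f i + f j)\<^sup>2) \<le> 4 * N" .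
  have "(2 * \<Phi> * N)\<^sup>2 \<le> (\<Sum>(i,j)\<in>X\<times>X. W i j * (\<bar>f i - f j\<bar> * (f i + f j)))\<^sup>2"
    using 1 N0 \<open>0 \<le> \<Phi>\<close> by (intro power_mono) auto
  also have "\<dots> \<le> (\<Sum>(i,j)\<in>X\<times>X. W i j * (f i - f j)\<^sup>2) * (\<Sum>(i,j)\<in>X\<times>X. W i j * (f i + f j)\<^sup>2)"
    using Cauchy_Schwarz_weighted[of "X\<times>X" "\<lambda>(i,j). W i j" "\<lambda>(i,j). \<bar>f i - f j\<bar>" "\<lambda>(i,j). f i + f j"] W
    by (force simp: case_prod_unfold)
  also have "\<dots> \<le> E * (4 * N)"
    using 2 E0 W unfolding E_def by (intro mult_mono) (auto simp: sum.cartesian_product intro!: sum_nonneg)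
  finally have "N * (\<Phi>\<^sup>2 * N) \<le> N * E" by (simp add: power2_eq_square algebra_simps)
  then have "\<Phi>\<^sup>2 * N \<le> E" using N0 E0
    by (cases "N = 0") (auto simp: mult_le_cancel_left)
  then show ?thesis by (simp add: N_def E_def)
qed

lemma median_exists:
  fixes g :: "'a \<Rightarrow> real"
  assumes "finite X" "X \<noteq> {}"
  obtains m where "2 * card {i\<in>X. m < g i} \<le> card X" "2 * card {i\<in>X. g i < m} \<le> card X"
proof -
  define V where "V = {v \<in> g ` X. 2 * card {i\<in>X. v < g i} \<le> card X}"
  have "\<not> Max (g ` X) < g i" if "i \<in> X" for i
    using Max_ge[of "g ` X" "g i"] assms that by (metis finite_imageI imageI not_less)
  then have "{i\<in>X. Max (g ` X) < g i} = {}" by blast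
  moreover have "Max (g ` X) \<in> g ` X" using assms by (intro Max_in) auto
  ultimately have "Max (g ` X) \<in> V"
    unfolding V_def by (intro CollectI conjI) (simp_all only: card.empty mult_0_right le0)
  then have "V \<noteq> {}" by blast
  moreover have "finite V" using assms(1) by (simp add: V_def)
  ultimately have V: "finite V" "V \<noteq> {}" by simp_all
  define m where "m = Min V"
  have "m \<in> V" using V by (simp add: m_def)
  have "2 * card {i\<in>X. g i < m} \<le> card X"
  proof (cases "{i\<in>X. g i < m} = {}")
    case False
    define m' where "m' = Max (g ` {i\<in>X. g i < m})"
    have "m' \<in> g ` {i\<in>X. g i < m}" unfolding m'_def using False assms by (intro Max_in) auto
    then have m': "m' \<in> g ` X" "m' < m" by auto
    have "m' \<notin> V" using m'(2) Min_le[OF V(1), of m'] unfolding m_def by linarith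
    then have 1: "card X < 2 * card {i\<in>X. m' < g i}" using m'(1) by (simp add: V_def)
    have 2: "{i\<in>X. m' < g i} = X - {i\<in>X. g i < m}"
    proof -
      have "g i \<le> m'" if "i \<in> X" "g i < m" for i unfolding m'_def using that assms by (intro Max_ge) auto
      then have "m' < g i \<longleftrightarrow> \<not> g i < m" if "i \<in> X" for i using that m'(2) by (meson leD less_le_trans not_le)
      then show ?thesis by blast
    qed
    have 3: "card (X - {i\<in>X. g i < m}) = card X - card {i\<in>X. g i < m}"
      using assms by (intro card_Diff_subset) auto
    show ?thesis using 1 unfolding 2 3 by linarith
  qed (simp only: card.empty mult_0_right le0)
  moreover have "2 * card {i\<in>X. m < g i} \<le> card X" using \<open>m \<in> V\<close> by (simp add: V_def)
  ultimately show ?thesis using that by blast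
qed

lemma Cheeger:
  fixes \<Phi> :: real and W :: "'a \<Rightarrow> 'a \<Rightarrow> real" and g :: "'a \<Rightarrow> real"
  assumes fin: "finite X" and W: "\<And>i j. i \<in> X \<Longrightarrow> j \<in> X \<Longrightarrow> 0 \<le> W i j"
    and row: "\<And>i. i \<in> X \<Longrightarrow> (\<Sum>j\<in>X. W i j) = 1" and col: "\<And>j. j \<in> X \<Longrightarrow> (\<Sum>i\<in>X. W i j) = 1"
    and iso: "\<And>S. S \<subseteq> X \<Longrightarrow> 2 * card S \<le> card X \<Longrightarrow>
      2 * \<Phi> * card S \<le> (\<Sum>i\<in>X. \<Sum>j\<in>X. W i j * \<bar>of_bool (i \<in> S) - of_bool (j \<in> S)\<bar>)"
    and "0 \<le> \<Phi>" and g: "(\<Sum>i\<in>X. g i) = 0"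
  shows "\<Phi>\<^sup>2 * (\<Sum>i\<in>X. (g i)\<^sup>2) \<le> (\<Sum>i\<in>X. \<Sum>j\<in>X. W i j * (g i - g j)\<^sup>2)"
proof (cases "X = {}")
  case False
  obtain m where m: "2 * card {i\<in>X. m < g i} \<le> card X" "2 * card {i\<in>X. g i < m} \<le> card X"
    using median_exists[OF fin False] .
  let ?f = "\<lambda>i. max (g i - m) 0" and ?f' = "\<lambda>i. max (m - g i) 0"
  have "(\<Sum>i\<in>X. (g i)\<^sup>2) \<le> (\<Sum>i\<in>X. (g i)\<^sup>2) + card X * m\<^sup>2" by simp
  also have "\<dots> = (\<Sum>i\<in>X. (g i)\<^sup>2) + card X * m\<^sup>2 - 2 * m * (\<Sum>i\<in>X. g i)" by (simp add: g)
  also have "\<dots> = (\<Sum>i\<in>X. (g i)\<^sup>2 + m\<^sup>2 - 2 * m * g i)"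
    by (simp add: sum.distrib sum_subtractf sum_distrib_left)
  also have "\<dots> = (\<Sum>i\<in>X. (?f i)\<^sup>2 + (?f' i)\<^sup>2)"
    by (intro sum.cong) (auto simp: max_def power2_eq_square algebra_simps)
  finally have "\<Phi>\<^sup>2 * (\<Sum>i\<in>X. (g i)\<^sup>2) \<le> \<Phi>\<^sup>2 * (\<Sum>i\<in>X. (?f i)\<^sup>2 + (?f' i)\<^sup>2)"
    by (intro mult_left_mono) auto
  also have "\<dots> = \<Phi>\<^sup>2 * (\<Sum>i\<in>X. (?f i)\<^sup>2) + \<Phi>\<^sup>2 * (\<Sum>i\<in>X. (?f' i)\<^sup>2)"
    by (simp add: sum.distrib distrib_left)
  also have "\<dots> \<le> (\<Sum>i\<in>X. \<Sum>j\<in>X. W i j * (?f i - ?f j)\<^sup>2) + (\<Sum>i\<in>X. \<Sum>j\<in>X. W i j * (?f' i - ?f' j)\<^sup>2)"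
    using m by (intro add_mono Cheeger_nonneg[OF fin W row col iso \<open>0 \<le> \<Phi>\<close>])
      (auto simp: less_max_iff_disj)
  also have "\<dots> \<le> (\<Sum>i\<in>X. \<Sum>j\<in>X. W i j * (g i - g j)\<^sup>2)"
  proof -
    have "(?f i - ?f j)\<^sup>2 + (?f' i - ?f' j)\<^sup>2 \<le> (g i - g j)\<^sup>2" for i j
    proof -
      have "0 \<le> (?f i - ?f j) * (?f' j - ?f' i)"
        by (cases "m \<le> g i"; cases "m \<le> g j")
          (auto simp: max_def mult_nonneg_nonneg mult_nonpos_nonpos mult_nonneg_nonpos mult_nonpos_nonneg)
      moreover have "g i - g j = (?f i - ?f j) + (?f' j - ?f' i)" by (auto simp: max_def)
      moreover have "x\<^sup>2 + y\<^sup>2 \<le> (x + y)\<^sup>2" if "0 \<le> x * y" for x y :: real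
        using that by (simp add: power2_eq_square algebra_simps)
      ultimately show ?thesis by (simp only: power2_commute[of "?f' i"])
    qed
    then have "W i j * (?f i - ?f j)\<^sup>2 + W i j * (?f' i - ?f' j)\<^sup>2 \<le> W i j * (g i - g j)\<^sup>2"
      if "i \<in> X" "j \<in> X" for i j
      using W[OF that] by (simp add: distrib_left[symmetric] mult_left_mono)
    then show ?thesis by (simp add: sum.distrib[symmetric] sum_mono)
  qed
  finally show ?thesis .
qed simp

section \<open>Contraction in mean square\<close>

lemma sum_square_expand:
  fixes A :: "'a \<Rightarrow> 'a \<Rightarrow> real"
  assumes row: "\<And>i. i \<in> X \<Longrightarrow> (\<Sum>j\<in>X. A i j) = 1" and col: "\<And>j. j \<in> X \<Longrightarrow> (\<Sum>i\<in>X. A i j) = 1"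
  shows "(\<Sum>i\<in>X. \<Sum>j\<in>X. A i j * (g i + s * g j)\<^sup>2)
    = (1 + s\<^sup>2) * (\<Sum>i\<in>X. (g i)\<^sup>2) + 2 * s * (\<Sum>i\<in>X. g i * (\<Sum>j\<in>X. A i j * g j))"
proof -
  have r: "(\<Sum>i\<in>X. \<Sum>j\<in>X. A i j * (g i)\<^sup>2) = (\<Sum>i\<in>X. (g i)\<^sup>2)"
    by (simp add: sum_distrib_right[symmetric] row)
  have c: "(\<Sum>i\<in>X. \<Sum>j\<in>X. A i j * (g j)\<^sup>2) = (\<Sum>i\<in>X. (g i)\<^sup>2)"
    by (subst sum.swap) (simp add: sum_distrib_right[symmetric] col)
  have "(\<Sum>i\<in>X. \<Sum>j\<in>X. A i j * (g i + s * g j)\<^sup>2)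
     = (\<Sum>i\<in>X. \<Sum>j\<in>X. A i j * (g i)\<^sup>2 + s\<^sup>2 * (A i j * (g j)\<^sup>2) + 2 * s * (g i * (A i j * g j)))"
    by (intro sum.cong refl) (simp add: power2_eq_square algebra_simps)
  also have "\<dots> = (1 + s\<^sup>2) * (\<Sum>i\<in>X. (g i)\<^sup>2) + 2 * s * (\<Sum>i\<in>X. g i * (\<Sum>j\<in>X. A i j * g j))"
    by (simp add: sum.distrib sum_distrib_left[symmetric] r c distrib_right)
  finally show ?thesis .
qed

text \<open>Each row of \<open>A\<close> is half a unit mass at the diagonal plus a rest of mass \<open>1/2\<close>; Cauchy--Schwarz is
  applied to the rest only.\<close>

lemma lazy_contraction:
  fixes A :: "'a \<Rightarrow> 'a \<Rightarrow> real"
  assumes fin: "finite X" and A: "\<And>i j. i \<in> X \<Longrightarrow> j \<in> X \<Longrightarrow> 0 \<le> A i j"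
    and row: "\<And>i. i \<in> X \<Longrightarrow> (\<Sum>j\<in>X. A i j) = 1" and col: "\<And>j. j \<in> X \<Longrightarrow> (\<Sum>i\<in>X. A i j) = 1"
    and lazy: "\<And>i. i \<in> X \<Longrightarrow> 1 / 2 \<le> A i i"
  shows "(\<Sum>i\<in>X. (\<Sum>j\<in>X. A i j * g j)\<^sup>2)
    \<le> (\<Sum>i\<in>X. (g i)\<^sup>2) - (\<Sum>i\<in>X. \<Sum>j\<in>X. A i j * (g i - g j)\<^sup>2) / 2"
proof -
  have "(\<Sum>j\<in>X. A i j * g j)\<^sup>2 \<le> (\<Sum>j\<in>X. A i j * (g j)\<^sup>2) - (\<Sum>j\<in>X. A i j * (g i - g j)\<^sup>2) / 2"
    if "i \<in> X" for i
  proof -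
    define a where "a j = A i j - of_bool (i = j) / 2" for j
    have a: "0 \<le> a j" if "j \<in> X" for j using A[OF \<open>i \<in> X\<close> that] lazy[OF \<open>i \<in> X\<close>] by (auto simp: a_def)
    have e: "(\<Sum>j\<in>X. A i j * c j) = c i / 2 + (\<Sum>j\<in>X. a j * c j)" for c :: "'a \<Rightarrow> real"
    proof -
      have "(\<Sum>j\<in>X. A i j * c j) = (\<Sum>j\<in>X. of_bool (i = j) * (c j / 2)) + (\<Sum>j\<in>X. a j * c j)"
        by (simp add: a_def sum.distrib[symmetric] algebra_simps)
      also have "(\<Sum>j\<in>X. of_bool (i = j) * (c j / 2)) = c i / 2"
      proof -
        have "(\<Sum>j\<in>X. of_bool (i = j) * (c j / 2)) = (\<Sum>j\<in>X. if j = i then c j / 2 else 0)"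
          by (intro sum.cong) auto
        then show ?thesis using fin \<open>i \<in> X\<close> by (simp only: sum.delta) simp
      qed
      finally show ?thesis .
    qed
    have sa: "(\<Sum>j\<in>X. a j) = 1 / 2" using e[of "\<lambda>_. 1"] row[OF that] by simp
    define M S where "M = (\<Sum>j\<in>X. a j * g j)" and "S = (\<Sum>j\<in>X. a j * (g j)\<^sup>2)"
    have "M\<^sup>2 \<le> S / 2"
      using Cauchy_Schwarz_weighted[of X a "\<lambda>_. 1" g] a by (simp add: sa M_def S_def)
    moreover have "(\<Sum>j\<in>X. a j * (g i - g j)\<^sup>2) = (g i)\<^sup>2 / 2 - 2 * g i * M + S"
    proof -
      have "(\<Sum>j\<in>X. a j * (g i - g j)\<^sup>2)
         = (\<Sum>j\<in>X. (g i)\<^sup>2 * a j - 2 * g i * (a j * g j) + a j * (g j)\<^sup>2)"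
        by (intro sum.cong refl) (simp add: power2_eq_square algebra_simps)
      then show ?thesis
        by (simp add: sum.distrib sum_subtractf sum_distrib_left[symmetric] sa M_def S_def)
    qed
    ultimately show ?thesis
      unfolding e M_def[symmetric] S_def[symmetric] by (simp add: power2_eq_square field_simps)
  qed
  then have "(\<Sum>i\<in>X. (\<Sum>j\<in>X. A i j * g j)\<^sup>2)
    \<le> (\<Sum>i\<in>X. (\<Sum>j\<in>X. A i j * (g j)\<^sup>2) - (\<Sum>j\<in>X. A i j * (g i - g j)\<^sup>2) / 2)"
    by (rule sum_mono)
  also have "\<dots> = (\<Sum>i\<in>X. (g i)\<^sup>2) - (\<Sum>i\<in>X. \<Sum>j\<in>X. A i j * (g i - g j)\<^sup>2) / 2"
  proof -
    have "(\<Sum>i\<in>X. \<Sum>j\<in>X. A i j * (g j)\<^sup>2) = (\<Sum>i\<in>X. (g i)\<^sup>2)"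
      by (subst sum.swap) (simp add: sum_distrib_right[symmetric] col)
    then show ?thesis by (simp add: sum_subtractf sum_divide_distrib)
  qed
  finally show ?thesis .
qed

lemma symmetric_contraction:
  fixes A :: "'a \<Rightarrow> 'a \<Rightarrow> real"
  assumes fin: "finite X" and sym: "\<And>i j. i \<in> X \<Longrightarrow> j \<in> X \<Longrightarrow> A i j = A j i"
    and row: "\<And>i. i \<in> X \<Longrightarrow> (\<Sum>j\<in>X. A i j) = 1"
    and minus: "\<And>g. (\<Sum>i\<in>X. g i) = 0 \<Longrightarrow>
      2 * c * (\<Sum>i\<in>X. (g i)\<^sup>2) \<le> (\<Sum>i\<in>X. \<Sum>j\<in>X. A i j * (g i - g j)\<^sup>2)"
    and plus: "\<And>g. (\<Sum>i\<in>X. g i) = 0 \<Longrightarrow>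
      2 * c * (\<Sum>i\<in>X. (g i)\<^sup>2) \<le> (\<Sum>i\<in>X. \<Sum>j\<in>X. A i j * (g i + g j)\<^sup>2)"
    and c: "0 \<le> c" "c \<le> 1" and g: "(\<Sum>i\<in>X. g i) = 0"
  shows "(\<Sum>i\<in>X. (\<Sum>j\<in>X. A i j * g j)\<^sup>2) \<le> (1 - c) * (\<Sum>i\<in>X. (g i)\<^sup>2)"
proof -
  have col: "(\<Sum>i\<in>X. A i j) = 1" if "j \<in> X" for j
    using row[OF that] sym that by (simp cong: sum.cong)
  define T where "T g i = (\<Sum>j\<in>X. A i j * g j)" for g i
  define Q where "Q g = (\<Sum>i\<in>X. g i * T g i)" for g
  define N where "N g = (\<Sum>i\<in>X. (g i)\<^sup>2)" for g :: "'a \<Rightarrow> real"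
  have N0: "0 \<le> N g" for g by (simp add: N_def sum_nonneg)
  have Q: "\<bar>Q h\<bar> \<le> (1 - c) * N h" if "(\<Sum>i\<in>X. h i) = 0" for h
    using minus[OF that] plus[OF that] sum_square_expand[OF row col, of h 1] sum_square_expand[OF row col, of h "-1"]
    by (simp add: Q_def N_def T_def algebra_simps abs_le_iff)
  define t where "t = N (T g)"
  have symT: "(\<Sum>i\<in>X. g i * T h i) = (\<Sum>i\<in>X. h i * T g i)" for g h
    unfolding T_def sum_distrib_left
    by (subst sum.swap) (auto intro!: sum.cong simp: sym algebra_simps)
  have Tg0: "(\<Sum>i\<in>X. T g i) = 0"
    unfolding T_def by (subst sum.swap) (simp add: sum_distrib_right[symmetric] col g)
  have TT: "T (\<lambda>i. a * g i + b * T g i) i = a * T g i + b * T (T g) i" for a b i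
    by (simp add: T_def sum.distrib sum_distrib_left algebra_simps)
  have Qe: "Q (\<lambda>i. a * g i + b * T g i) = a\<^sup>2 * Q g + 2 * a * b * t + b\<^sup>2 * Q (T g)" for a b
  proof -
    have "Q (\<lambda>i. a * g i + b * T g i) = (\<Sum>i\<in>X. a\<^sup>2 * (g i * T g i) + a * b * (g i * T (T g) i)
        + a * b * (T g i * T g i) + b\<^sup>2 * (T g i * T (T g) i))"
      unfolding Q_def TT by (intro sum.cong refl) (simp add: power2_eq_square algebra_simps)
    also have "\<dots> = a\<^sup>2 * Q g + a * b * (\<Sum>i\<in>X. g i * T (T g) i) + a * b * t + b\<^sup>2 * Q (T g)"
      by (simp add: sum.distrib sum_distrib_left[symmetric] Q_def t_def N_def power2_eq_square)
    also have "(\<Sum>i\<in>X. g i * T (T g) i) = t"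
      by (subst symT) (simp add: t_def N_def power2_eq_square)
    finally show ?thesis by simp
  qed
  have Ne: "N (\<lambda>i. a * g i + b * T g i) = a\<^sup>2 * N g + 2 * a * b * Q g + b\<^sup>2 * t" for a b
  proof -
    have "N (\<lambda>i. a * g i + b * T g i) = (\<Sum>i\<in>X. a\<^sup>2 * (g i)\<^sup>2 + 2 * a * b * (g i * T g i) + b\<^sup>2 * (T g i)\<^sup>2)"
      unfolding N_def by (intro sum.cong refl) (simp add: power2_eq_square algebra_simps)
    then show ?thesis by (simp add: sum.distrib sum_distrib_left[symmetric] N_def Q_def t_def)
  qed
  have z: "(\<Sum>i\<in>X. a * g i + b * T g i) = 0" for a b
    by (simp add: sum.distrib sum_distrib_left[symmetric] g Tg0)
  have main: "2 * a * b * t \<le> (1 - c) * (a\<^sup>2 * N g + b\<^sup>2 * t)" for a b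
    using Q[OF z, of a b] Q[OF z, of a "-b"] unfolding Qe Ne by (simp add: algebra_simps abs_le_iff)
  have "t \<le> (1 - c)\<^sup>2 * N g"
  proof (cases "t = 0 \<or> c = 1")
    case False
    have "0 < 1 - c" using False c by simp
    have "2 * (1 - c) * t \<le> (1 - c) * ((1 - c)\<^sup>2 * N g + t)"
      using main[of "1 - c" 1] by simp
    then have "(1 - c) * (2 * t) \<le> (1 - c) * ((1 - c)\<^sup>2 * N g + t)" by (simp only: mult.assoc mult.left_commute)
    then have "2 * t \<le> (1 - c)\<^sup>2 * N g + t" using \<open>0 < 1 - c\<close> mult_le_cancel_left_pos by blast
    then show ?thesis by simp
  next
    case True
    then show ?thesis
    proof
      assume "c = 1"
      then show ?thesis using main[of 1 1] by simp
    qed (simp add: N0)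
  qed
  also have "\<dots> \<le> (1 - c) * N g"
    using c N0[of g] by (intro mult_right_mono) (auto simp: power2_eq_square mult_left_le)
  finally show ?thesis by (simp add: t_def N_def T_def)
qed

section \<open>Mixing times of doubly stochastic chains\<close>

definition doubly_stochastic :: "nat \<Rightarrow> real mat \<Rightarrow> bool" where
  "doubly_stochastic n P \<longleftrightarrow> P \<in> carrier_mat n n \<and> (\<forall>i<n. \<forall>j<n. 0 \<le> P $$ (i, j)) \<and>
     (\<forall>i<n. (\<Sum>j<n. P $$ (i, j)) = 1) \<and> (\<forall>j<n. (\<Sum>i<n. P $$ (i, j)) = 1)"

lemma evolve_0:
  assumes "P \<in> carrier_mat n n" "\<sigma> \<in> carrier_vec n"
  shows "evolve P 0 \<sigma> = \<sigma>"
  using assms by (auto simp: evolve_def)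

lemma evolve_carrier:
  assumes "P \<in> carrier_mat n n"
  shows "evolve P k \<sigma> \<in> carrier_vec n"
  using pow_carrier_mat[OF assms, of k] by (auto simp: evolve_def intro!: carrier_vecI)

lemma evolve_Suc:
  assumes P: "P \<in> carrier_mat n n" and \<sigma>: "\<sigma> \<in> carrier_vec n"
  shows "evolve P (Suc k) \<sigma> = evolve P 1 (evolve P k \<sigma>)"
proof -
  have "transpose_mat (P ^\<^sub>m k * P) *\<^sub>v \<sigma> = (transpose_mat P * transpose_mat (P ^\<^sub>m k)) *\<^sub>v \<sigma>"
    using P pow_carrier_mat[OF P, of k] by (subst transpose_mult) auto
  also have "\<dots> = transpose_mat P *\<^sub>v (transpose_mat (P ^\<^sub>m k) *\<^sub>v \<sigma>)"
    using P \<sigma> pow_carrier_mat[OF P, of k] by (subst assoc_mult_mat_vec) auto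
  finally show ?thesis using P by (simp add: evolve_def)
qed

lemma evolve_1_index:
  assumes "P \<in> carrier_mat n n" "\<sigma> \<in> carrier_vec n" "j < n"
  shows "evolve P 1 \<sigma> $ j = (\<Sum>i<n. P $$ (i, j) * \<sigma> $ i)"
  using assms by (auto simp: evolve_def scalar_prod_def atLeast0LessThan intro!: sum.cong)

lemma evolve_Suc_index:
  assumes "P \<in> carrier_mat n n" "\<sigma> \<in> carrier_vec n" "j < n"
  shows "evolve P (Suc k) \<sigma> $ j = (\<Sum>i<n. P $$ (i, j) * evolve P k \<sigma> $ i)"
  using evolve_1_index[OF assms(1) evolve_carrier[OF assms(1)] assms(3)] evolve_Suc[OF assms(1,2)]
  by simp

lemma evolve_prob_vecs:
  assumes P: "doubly_stochastic n P" and \<sigma>: "\<sigma> \<in> prob_vecs n"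
  shows "evolve P k \<sigma> \<in> prob_vecs n"
proof (induction k)
  case 0
  then show ?case using assms evolve_0[of P n \<sigma>] by (auto simp: doubly_stochastic_def prob_vecs_def)
next
  case (Suc k)
  have c: "P \<in> carrier_mat n n" "\<sigma> \<in> carrier_vec n" using assms by (auto simp: doubly_stochastic_def prob_vecs_def)
  have "(\<Sum>j<n. \<Sum>i<n. P $$ (i, j) * evolve P k \<sigma> $ i) = (\<Sum>i<n. (\<Sum>j<n. P $$ (i, j)) * evolve P k \<sigma> $ i)"
    by (subst sum.swap) (simp add: sum_distrib_right)
  also have "\<dots> = (\<Sum>i<n. evolve P k \<sigma> $ i)"
    using P by (intro sum.cong) (auto simp: doubly_stochastic_def)
  finally show ?case using Suc P c
    by (auto simp: prob_vecs_def evolve_carrier evolve_Suc_index doubly_stochastic_def intro!: sum_nonneg)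
qed

lemma tv_dist_le:
  assumes "\<mu> \<in> carrier_vec n"
  shows "tv_dist \<mu> \<nu> \<le> (\<Sum>i<n. \<bar>\<mu> $ i - \<nu> $ i\<bar>)"
  unfolding tv_dist_def
proof (rule Max.boundedI)
  fix x assume "x \<in> (\<lambda>A. \<bar>(\<Sum>i\<in>A. \<mu> $ i) - (\<Sum>i\<in>A. \<nu> $ i)\<bar>) ` Pow {..<dim_vec \<mu>}"
  then obtain A where A: "A \<subseteq> {..<n}" "x = \<bar>(\<Sum>i\<in>A. \<mu> $ i) - (\<Sum>i\<in>A. \<nu> $ i)\<bar>"
    using assms by auto
  have "x = \<bar>\<Sum>i\<in>A. \<mu> $ i - \<nu> $ i\<bar>" by (simp add: A sum_subtractf)
  also have "\<dots> \<le> (\<Sum>i\<in>A. \<bar>\<mu> $ i - \<nu> $ i\<bar>)" by (rule sum_abs)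
  also have "\<dots> \<le> (\<Sum>i<n. \<bar>\<mu> $ i - \<nu> $ i\<bar>)" using A by (intro sum_mono2) auto
  finally show "x \<le> (\<Sum>i<n. \<bar>\<mu> $ i - \<nu> $ i\<bar>)" .
qed auto

lemma tv_dist_ge:
  assumes "\<mu> \<in> carrier_vec n" "A \<subseteq> {..<n}"
  shows "\<bar>(\<Sum>i\<in>A. \<mu> $ i) - (\<Sum>i\<in>A. \<nu> $ i)\<bar> \<le> tv_dist \<mu> \<nu>"
  unfolding tv_dist_def using assms by (intro Max_ge) auto

definition uniform_vec :: "nat \<Rightarrow> real vec" where
  "uniform_vec n = vec n (\<lambda>_. 1 / n)"

definition l2_contraction :: "nat \<Rightarrow> real mat \<Rightarrow> real \<Rightarrow> bool" where
  "l2_contraction n P c \<longleftrightarrow> (\<forall>g. (\<Sum>i<n. g i) = 0 \<longrightarrow>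
     (\<Sum>j<n. (\<Sum>i<n. P $$ (i, j) * g i)\<^sup>2) \<le> (1 - c) * (\<Sum>i<n. (g i)\<^sup>2))"

lemma l2_decay:
  assumes P: "doubly_stochastic n P" and con: "l2_contraction n P c" and "c \<le> 1"
    and \<sigma>: "\<sigma> \<in> prob_vecs n" and "0 < n"
  shows "(\<Sum>j<n. (evolve P k \<sigma> $ j - 1 / n)\<^sup>2) \<le> (1 - c) ^ k"
proof (induction k)
  have c: "P \<in> carrier_mat n n" "\<sigma> \<in> carrier_vec n" using assms by (auto simp: doubly_stochastic_def prob_vecs_def)
  {
    case 0
    have "\<sigma> $ i \<le> 1" if "i < n" for i
      using \<sigma> member_le_sum[of i "{..<n}" "\<lambda>i. \<sigma> $ i"] that by (auto simp: prob_vecs_def)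
    then have "(\<sigma> $ i)\<^sup>2 \<le> \<sigma> $ i" if "i < n" for i
      using \<sigma> that by (auto simp: prob_vecs_def power2_eq_square intro: mult_left_le)
    then have 1: "(\<Sum>i<n. (\<sigma> $ i)\<^sup>2) \<le> 1"
      using \<sigma> sum_mono[of "{..<n}" "\<lambda>i. (\<sigma> $ i)\<^sup>2" "\<lambda>i. \<sigma> $ i"] by (auto simp: prob_vecs_def)
    have "(\<Sum>j<n. (\<sigma> $ j - 1 / n)\<^sup>2) = (\<Sum>j<n. (\<sigma> $ j)\<^sup>2 - 2 / n * \<sigma> $ j + 1 / n ^ 2)"
      by (intro sum.cong) (auto simp: power2_eq_square algebra_simps)
    also have "\<dots> = (\<Sum>i<n. (\<sigma> $ i)\<^sup>2) - 2 / n * (\<Sum>j<n. \<sigma> $ j) + n * (1 / n ^ 2)"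
      unfolding sum_distrib_left by (simp add: sum.distrib sum_subtractf)
    also have "\<dots> = (\<Sum>i<n. (\<sigma> $ i)\<^sup>2) - 1 / n"
      using \<sigma> \<open>0 < n\<close> by (simp add: prob_vecs_def power2_eq_square)
    also have "\<dots> \<le> 1" using 1 by (simp add: add_increasing2 diff_le_eq)
    finally show ?case using c by (simp add: evolve_0)
  next
    case (Suc k)
    define g where "g i = evolve P k \<sigma> $ i - 1 / n" for i
    have "(\<Sum>i<n. g i) = 0"
      using evolve_prob_vecs[OF P \<sigma>, of k] \<open>0 < n\<close> by (simp add: g_def sum_subtractf prob_vecs_def)
    then have "(\<Sum>j<n. (\<Sum>i<n. P $$ (i, j) * g i)\<^sup>2) \<le> (1 - c) * (\<Sum>i<n. (g i)\<^sup>2)"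
      using con by (simp add: l2_contraction_def)
    also have "\<dots> \<le> (1 - c) * (1 - c) ^ k"
      using Suc \<open>c \<le> 1\<close> by (intro mult_left_mono) (auto simp: g_def)
    finally have "(\<Sum>j<n. (\<Sum>i<n. P $$ (i, j) * g i)\<^sup>2) \<le> (1 - c) ^ Suc k" by simp
    moreover have "(\<Sum>i<n. P $$ (i, j) * g i) = evolve P (Suc k) \<sigma> $ j - 1 / n" if "j < n" for j
      using P that c
      by (simp add: g_def right_diff_distrib sum_subtractf evolve_Suc_index sum_divide_distrib[symmetric] doubly_stochastic_def)
    ultimately show ?case by simp
  }
qed

lemma stationary_dist_uniform:
  assumes P: "doubly_stochastic n P" and con: "l2_contraction n P c" and c: "0 < c" "c \<le> 1" and "0 < n"
  shows "stationary_dist P = uniform_vec n"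
proof -
  have cP: "P \<in> carrier_mat n n" using P by (auto simp: doubly_stochastic_def)
  have u: "uniform_vec n \<in> prob_vecs n" using \<open>0 < n\<close> by (simp add: uniform_vec_def prob_vecs_def)
  have stat: "evolve P 1 (uniform_vec n) = uniform_vec n"
  proof (rule eq_vecI)
    show "dim_vec (evolve P 1 (uniform_vec n)) = dim_vec (uniform_vec n)"
      using evolve_carrier[OF cP, of 1] by (simp add: uniform_vec_def)
  next
    fix j assume "j < dim_vec (uniform_vec n)"
    then have "j < n" by (simp add: uniform_vec_def)
    have "evolve P 1 (uniform_vec n) $ j = (\<Sum>i<n. P $$ (i, j) * uniform_vec n $ i)"
      using \<open>j < n\<close> by (intro evolve_1_index[OF cP]) (auto simp: uniform_vec_def)
    also have "\<dots> = (\<Sum>i<n. P $$ (i, j)) / n"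
      by (simp add: uniform_vec_def sum_divide_distrib)
    finally show "evolve P 1 (uniform_vec n) $ j = uniform_vec n $ j"
      using P \<open>j < n\<close> by (simp add: doubly_stochastic_def uniform_vec_def)
  qed
  have "\<pi> = uniform_vec n" if "\<pi> \<in> prob_vecs n" "evolve P 1 \<pi> = \<pi>" for \<pi>
  proof -
    have c\<pi>: "\<pi> \<in> carrier_vec n" using that by (simp add: prob_vecs_def)
    have "evolve P k \<pi> = \<pi>" for k
    proof (induction k)
      case (Suc k)
      then show ?case by (metis evolve_Suc[OF cP c\<pi>] that(2))
    qed (rule evolve_0[OF cP c\<pi>])
    then have "(\<Sum>j<n. (\<pi> $ j - 1 / n)\<^sup>2) \<le> (1 - c) ^ k" for k
      using l2_decay[OF P con c(2) that(1) \<open>0 < n\<close>, of k] by simp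
    moreover have "(\<lambda>k. (1 - c) ^ k) \<longlonglongrightarrow> 0" using c by (intro LIMSEQ_power_zero) auto
    ultimately have "(\<Sum>j<n. (\<pi> $ j - 1 / n)\<^sup>2) \<le> 0" by (intro LIMSEQ_le_const) auto
    then have "(\<Sum>j<n. (\<pi> $ j - 1 / n)\<^sup>2) = 0" by (simp add: antisym sum_nonneg)
    then have "\<pi> $ j = 1 / n" if "j < n" for j using that by (auto simp: sum_nonneg_eq_0_iff)
    then show ?thesis using c\<pi> by (intro eq_vecI) (auto simp: uniform_vec_def)
  qed
  then have "(THE \<pi>. \<pi> \<in> prob_vecs n \<and> evolve P 1 \<pi> = \<pi>) = uniform_vec n"
    using u stat by (intro the_equality) blast+
  moreover have "dim_row P = n" using cP by simp
  ultimately show ?thesis by (simp only: stationary_dist_def)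
qed

lemma t_mix_upper:
  assumes P: "doubly_stochastic n P" and con: "l2_contraction n P c" and c: "0 < c" "c \<le> 1" and "0 < n"
    and "0 < \<epsilon>" and k: "n * (1 - c) ^ k \<le> \<epsilon>\<^sup>2"
  shows "t_mix P \<epsilon> \<le> enat k"
proof -
  have cP: "P \<in> carrier_mat n n" using P by (auto simp: doubly_stochastic_def)
  have "tv_dist (evolve P k \<sigma>) (uniform_vec n) \<le> \<epsilon>" if "\<sigma> \<in> prob_vecs n" for \<sigma>
  proof -
    let ?g = "\<lambda>j. evolve P k \<sigma> $ j - 1 / n"
    have "(\<Sum>j<n. \<bar>?g j\<bar>)\<^sup>2 \<le> n * (\<Sum>j<n. (?g j)\<^sup>2)"
      using Cauchy_Schwarz_ineq_sum[of "\<lambda>j. 1" "\<lambda>j. \<bar>?g j\<bar>" "{..<n}"] by simp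
    also have "\<dots> \<le> n * (1 - c) ^ k"
      using l2_decay[OF P con c(2) that \<open>0 < n\<close>, of k] by (intro mult_left_mono) auto
    also have "\<dots> \<le> \<epsilon>\<^sup>2" by (rule k)
    finally have "(\<Sum>j<n. \<bar>?g j\<bar>) \<le> \<epsilon>" using \<open>0 < \<epsilon>\<close> power2_le_imp_le by force
    moreover have "(\<Sum>j<n. \<bar>evolve P k \<sigma> $ j - uniform_vec n $ j\<bar>) = (\<Sum>j<n. \<bar>?g j\<bar>)"
      by (intro sum.cong) (auto simp: uniform_vec_def)
    ultimately show ?thesis using tv_dist_le[OF evolve_carrier[OF cP], of k \<sigma> "uniform_vec n"] by simp
  qed
  then show ?thesis
    unfolding t_mix_def stationary_dist_uniform[OF P con c \<open>0 < n\<close>]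
    using cP by (intro SUP_least INF_lower) auto
qed

lemma t_mix_lower:
  assumes "\<sigma> \<in> prob_vecs (dim_row P)" and "0 \<le> T"
    and "\<And>k. real k \<le> T \<Longrightarrow> \<epsilon> < tv_dist (evolve P k \<sigma>) (stationary_dist P)"
  shows "ereal T < ereal_of_enat (t_mix P \<epsilon>)"
proof -
  have "Suc (nat \<lfloor>T\<rfloor>) \<le> k" if "tv_dist (evolve P k \<sigma>) (stationary_dist P) \<le> \<epsilon>" for k
  proof -
    have "T < real k" using assms(3)[of k] that by (meson not_le)
    then have "\<lfloor>T\<rfloor> < int k" by (simp add: floor_less_iff)
    then show ?thesis using \<open>0 \<le> T\<close> by linarith
  qed
  then have "enat (Suc (nat \<lfloor>T\<rfloor>)) \<le> (INF k \<in> {k. tv_dist (evolve P k \<sigma>) (stationary_dist P) \<le> \<epsilon>}. enat k)"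
    by (intro INF_greatest) auto
  also have "\<dots> \<le> t_mix P \<epsilon>" unfolding t_mix_def using assms(1) by (rule SUP_upper)
  finally have "ereal_of_enat (enat (Suc (nat \<lfloor>T\<rfloor>))) \<le> ereal_of_enat (t_mix P \<epsilon>)"
    by (simp only: ereal_of_enat_le_iff)
  moreover have "T < real (Suc (nat \<lfloor>T\<rfloor>))" by linarith
  ultimately show ?thesis
    by (metis ereal_of_enat_simps(1) ereal_less_eq(3) less_ereal.simps(1) order.strict_trans2)
qed

text \<open>The mass that has left the sublevel set \<open>{f < F}\<close> of a test function with drift at most
  \<open>\<beta>\<close> is controlled by Markov's inequality.\<close>

lemma tv_lower_by_drift:
  assumes P: "doubly_stochastic n P" and "a < n" "f a = 0" and f: "\<And>i. i < n \<Longrightarrow> 0 \<le> f i" and "0 < F"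
    and drift: "\<And>i. i < n \<Longrightarrow> (\<Sum>j<n. P $$ (i, j) * f j) \<le> f i + \<beta>"
  shows "1 - k * \<beta> / F - card {i\<in>{..<n}. f i < F} / n
    \<le> tv_dist (evolve P k (unit_vec n a)) (uniform_vec n)"
proof -
  have cP: "P \<in> carrier_mat n n" using P by (auto simp: doubly_stochastic_def)
  let ?\<mu> = "\<lambda>k. evolve P k (unit_vec n a)"
  have p: "unit_vec n a \<in> prob_vecs n"
    using \<open>a < n\<close> by (auto simp: prob_vecs_def unit_vec_def)
  have E: "(\<Sum>j<n. ?\<mu> k $ j * f j) \<le> k * \<beta>" for k
  proof (induction k)
    case 0
    have "(\<Sum>j<n. unit_vec n a $ j * f j) = (\<Sum>j<n. if j = a then f j else 0)"
      using \<open>a < n\<close> by (intro sum.cong) (auto simp: unit_vec_def)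
    then show ?case using \<open>f a = 0\<close> \<open>a < n\<close> by (simp add: evolve_0[OF cP])
  next
    case (Suc k)
    have "(\<Sum>j<n. ?\<mu> (Suc k) $ j * f j) = (\<Sum>j<n. \<Sum>i<n. ?\<mu> k $ i * (P $$ (i, j) * f j))"
      by (simp add: evolve_Suc_index[OF cP] sum_distrib_right mult.assoc mult.left_commute)
    also have "\<dots> = (\<Sum>i<n. ?\<mu> k $ i * (\<Sum>j<n. P $$ (i, j) * f j))"
      by (subst sum.swap) (simp add: sum_distrib_left)
    also have "\<dots> \<le> (\<Sum>i<n. ?\<mu> k $ i * (f i + \<beta>))"
      using evolve_prob_vecs[OF P p, of k] drift
      by (intro sum_mono mult_left_mono) (auto simp: prob_vecs_def)
    also have "\<dots> = (\<Sum>i<n. ?\<mu> k $ i * f i) + \<beta>"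
      using evolve_prob_vecs[OF P p, of k]
      by (simp add: distrib_left sum.distrib sum_distrib_right[symmetric] prob_vecs_def)
    also have "\<dots> \<le> Suc k * \<beta>" using Suc by (simp add: algebra_simps)
    finally show ?case .
  qed
  let ?A = "{i\<in>{..<n}. f i < F}"
  have \<mu>: "\<And>i. i < n \<Longrightarrow> 0 \<le> ?\<mu> k $ i" "(\<Sum>i<n. ?\<mu> k $ i) = 1"
    using evolve_prob_vecs[OF P p, of k] by (auto simp: prob_vecs_def)
  have "(\<Sum>i<n. ?\<mu> k $ i) = (\<Sum>i\<in>?A. ?\<mu> k $ i) + (\<Sum>i\<in>{..<n} - ?A. ?\<mu> k $ i)"
    by (subst sum.subset_diff[of ?A]) auto
  moreover have "(\<Sum>i\<in>{..<n} - ?A. ?\<mu> k $ i) \<le> k * \<beta> / F"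
  proof -
    have "F * (\<Sum>i\<in>{..<n} - ?A. ?\<mu> k $ i) \<le> (\<Sum>i\<in>{..<n} - ?A. ?\<mu> k $ i * f i)"
      unfolding sum_distrib_left
    proof (rule sum_mono)
      fix i assume "i \<in> {..<n} - ?A"
      then show "F * ?\<mu> k $ i \<le> ?\<mu> k $ i * f i"
        using \<mu>(1)[of i] mult_left_mono[of F "f i" "?\<mu> k $ i"] by (auto simp: mult.commute)
    qed
    also have "\<dots> \<le> (\<Sum>i<n. ?\<mu> k $ i * f i)"
      using \<mu>(1) f by (intro sum_mono2) auto
    also have "\<dots> \<le> k * \<beta>" by (rule E)
    finally show ?thesis using \<open>0 < F\<close> by (simp add: field_simps)
  qed
  moreover have "(\<Sum>i\<in>?A. uniform_vec n $ i) = card ?A / n"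
    by (simp add: uniform_vec_def)
  ultimately have "1 - k * \<beta> / F - card ?A / n \<le> \<bar>(\<Sum>i\<in>?A. ?\<mu> k $ i) - (\<Sum>i\<in>?A. uniform_vec n $ i)\<bar>"
    using \<mu>(2) by linarith
  also have "\<dots> \<le> tv_dist (?\<mu> k) (uniform_vec n)"
    using evolve_carrier[OF cP] by (intro tv_dist_ge) auto
  finally show ?thesis .
qed

section \<open>The homogeneous chain\<close>

lemma hom_trans_reverse: "hom_trans n L q\<^sub>c q\<^sub>l r d j i = hom_trans n L q\<^sub>c q\<^sub>l (- r) d i j"
  by (simp add: hom_trans_def insert_commute)

lemma hom_trans_self:
  assumes "2 \<le> n" "L \<subseteq> node_pairs n" "i < n"
  shows "hom_trans n L q\<^sub>c q\<^sub>l r d i i = 0"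
proof -
  have "i \<noteq> (i + 1) mod n" using assms by (cases "i + 1 = n") auto
  moreover have "{i, i} \<notin> L" using assms by (auto simp: node_pairs_def)
  ultimately show ?thesis by (simp add: hom_trans_def)
qed

lemma long_degree_eq_sum:
  assumes "L \<subseteq> node_pairs n" "i < n"
  shows "real (long_degree L i) = (\<Sum>j<n. of_bool ({i, j} \<in> L))"
proof -
  have "{e \<in> L. i \<in> e} = (\<lambda>j. {i, j}) ` {j\<in>{..<n}. {i, j} \<in> L}"
  proof (intro equalityI subsetI)
    fix e assume e: "e \<in> {e \<in> L. i \<in> e}"
    then have "e \<subseteq> {..<n}" "card e = 2" using assms by (auto simp: node_pairs_def)
    then obtain j where "e = {i, j}" using e by (auto simp: card_2_iff)
    then show "e \<in> (\<lambda>j. {i, j}) ` {j\<in>{..<n}. {i, j} \<in> L}" using e \<open>e \<subseteq> {..<n}\<close> by auto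
  qed auto
  moreover have "inj_on (\<lambda>j. {i, j}) {j\<in>{..<n}. {i, j} \<in> L}"
    by (auto simp: inj_on_def doubleton_eq_iff)
  ultimately have "long_degree L i = card {j\<in>{..<n}. {i, j} \<in> L}"
    by (simp add: long_degree_def card_image)
  then show ?thesis by (simp add: Int_def)
qed

lemma cyclic_pred_iff:
  assumes "i < n" "j < (n :: nat)"
  shows "i = (j + 1) mod n \<longleftrightarrow> j = (if i = 0 then n - 1 else i - 1)"
  using assms by (cases "j + 1 = n") auto

lemma sum_cyclic_shift:
  fixes f :: "nat \<Rightarrow> 'a :: comm_monoid_add"
  shows "(\<Sum>x<n. f ((x + t) mod n)) = (\<Sum>x<n. f x)"
proof (induction t arbitrary: f)
  case (Suc t)
  have "(\<Sum>x<n. f ((x + Suc t) mod n)) = (\<Sum>x<n. f (Suc ((x + t) mod n) mod n))"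
    by (simp add: mod_Suc_eq)
  also have "\<dots> = (\<Sum>x<n. f (Suc x mod n))" by (rule Suc.IH)
  also have "\<dots> = (\<Sum>x<n. f x)"
  proof (cases n)
    case (Suc m)
    have "(\<Sum>x<n. f (Suc x mod n)) = (\<Sum>x<m. f (Suc x mod n)) + f (Suc m mod n)" by (simp add: Suc)
    also have "(\<Sum>x<m. f (Suc x mod n)) = (\<Sum>x<m. f (Suc x))" by (intro sum.cong) (auto simp: Suc)
    finally show ?thesis using sum.lessThan_Suc_shift[of f m] by (simp add: Suc add.commute)
  qed simp
  finally show ?case .
qed simp

lemma hom_trans_sum:
  assumes "i < n"
  shows "(\<Sum>j<n. hom_trans n L q\<^sub>c q\<^sub>l r d i j * f j) =
    (q\<^sub>c + r) * f ((i + 1) mod n) + (q\<^sub>c - r) * f (if i = 0 then n - 1 else i - 1) +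
    q\<^sub>l / d * (\<Sum>j<n. of_bool ({i, j} \<in> L) * f j)"
proof -
  define p where "p = (if i = 0 then n - 1 else i - 1)"
  define s where "s = (i + 1) mod n"
  have "p < n" "s < n" using assms by (auto simp: p_def s_def)
  have "(\<Sum>j<n. hom_trans n L q\<^sub>c q\<^sub>l r d i j * f j) =
     (\<Sum>j<n. (if j = s then (q\<^sub>c + r) * f j else 0) + (if j = p then (q\<^sub>c - r) * f j else 0) +
       q\<^sub>l / d * (of_bool ({i, j} \<in> L) * f j))"
  proof (intro sum.cong refl)
    fix j assume "j \<in> {..<n}"
    then have "i = (j + 1) mod n \<longleftrightarrow> j = p" unfolding p_def using assms by (intro cyclic_pred_iff) auto
    then show "hom_trans n L q\<^sub>c q\<^sub>l r d i j * f j = (if j = s then (q\<^sub>c + r) * f j else 0) +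
        (if j = p then (q\<^sub>c - r) * f j else 0) + q\<^sub>l / d * (of_bool ({i, j} \<in> L) * f j)"
      unfolding hom_trans_def s_def[symmetric] by (simp add: distrib_right)
  qed
  then show ?thesis using \<open>p < n\<close> \<open>s < n\<close>
    unfolding p_def[symmetric] s_def[symmetric]
    by (simp add: sum.distrib sum_distrib_left del: sum_of_bool_mult_eq sum_mult_of_bool_eq)
qed

locale long_range =
  fixes n :: nat and L :: "nat set set" and q\<^sub>c q\<^sub>l r d :: real
  assumes n: "3 \<le> n" and L: "L \<subseteq> node_pairs n"
    and pos: "0 < q\<^sub>c" "0 < q\<^sub>l" and r: "\<bar>r\<bar> \<le> q\<^sub>c" and le1: "2 * q\<^sub>c + q\<^sub>l \<le> 1"
    and d: "1 \<le> d" and deg: "\<And>i. i < n \<Longrightarrow> real (long_degree L i) \<le> d"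
begin

abbreviation "P \<equiv> hom_chain n L q\<^sub>c q\<^sub>l r d"

definition "hold i = 1 - 2 * q\<^sub>c - q\<^sub>l / d * real (long_degree L i)"

lemma hold_nonneg: "0 \<le> hold i" if "i < n"
proof -
  have "q\<^sub>l / d * real (long_degree L i) \<le> q\<^sub>l / d * d"
    using deg[OF that] d pos by (intro mult_left_mono) auto
  then show ?thesis using le1 d by (simp add: hold_def)
qed

lemma hom_trans_row_sum:
  assumes "i < n"
  shows "(\<Sum>j<n. hom_trans n L q\<^sub>c q\<^sub>l s d i j) = 2 * q\<^sub>c + q\<^sub>l / d * real (long_degree L i)"
  using hom_trans_sum[OF assms, of L q\<^sub>c q\<^sub>l s d "\<lambda>_. 1"] long_degree_eq_sum[OF L assms] by simp

lemma P_entry: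
  assumes "i < n" "j < n"
  shows "P $$ (i, j) = hom_trans n L q\<^sub>c q\<^sub>l r d i j + of_bool (i = j) * hold i"
proof -
  have s: "hom_trans n L q\<^sub>c q\<^sub>l r d i i = 0" using n L assms by (intro hom_trans_self) auto
  then have "(\<Sum>k\<in>{..<n} - {i}. hom_trans n L q\<^sub>c q\<^sub>l r d i k) = (\<Sum>k<n. hom_trans n L q\<^sub>c q\<^sub>l r d i k)"
    using assms by (simp add: sum_diff1)
  also have "\<dots> = 2 * q\<^sub>c + q\<^sub>l / d * real (long_degree L i)" by (rule hom_trans_row_sum[OF assms(1)])
  finally show ?thesis using assms s by (cases "i = j") (simp_all add: hom_chain_def hold_def)
qed

lemma P_sum:
  assumes "i < n"
  shows "(\<Sum>j<n. P $$ (i, j) * f j) =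
    (q\<^sub>c + r) * f ((i + 1) mod n) + (q\<^sub>c - r) * f (if i = 0 then n - 1 else i - 1) +
    q\<^sub>l / d * (\<Sum>j<n. of_bool ({i, j} \<in> L) * f j) + hold i * f i"
proof -
  have "(\<Sum>j<n. P $$ (i, j) * f j) =
      (\<Sum>j<n. hom_trans n L q\<^sub>c q\<^sub>l r d i j * f j + (if i = j then hold i * f j else 0))"
    using assms by (intro sum.cong) (auto simp: P_entry distrib_right)
  then show ?thesis using assms by (simp add: sum.distrib hom_trans_sum)
qed

lemma doubly_stochastic_P: "doubly_stochastic n P"
  unfolding doubly_stochastic_def
proof (intro conjI allI impI)
  show "P \<in> carrier_mat n n" by (simp add: hom_chain_def)
next
  fix i j assume "i < n" "j < n"
  have "0 \<le> hom_trans n L q\<^sub>c q\<^sub>l r d i j"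
    unfolding hom_trans_def using r pos d by (intro add_nonneg_nonneg) auto
  then show "0 \<le> P $$ (i, j)"
    using hold_nonneg[of i] \<open>i < n\<close> \<open>j < n\<close> by (simp add: P_entry)
next
  fix i assume "i < n"
  then show "(\<Sum>j<n. P $$ (i, j)) = 1"
    using P_sum[of i "\<lambda>_. 1"] long_degree_eq_sum[OF L, of i] by (simp add: hold_def)
next
  fix j assume j: "j < n"
  have "(\<Sum>i<n. P $$ (i, j)) = (\<Sum>i<n. hom_trans n L q\<^sub>c q\<^sub>l (- r) d j i + (if i = j then hold i else 0))"
    using j by (intro sum.cong) (auto simp: P_entry hom_trans_reverse[of n L q\<^sub>c q\<^sub>l r])
  then show "(\<Sum>i<n. P $$ (i, j)) = 1"
    using j by (simp add: sum.distrib hom_trans_row_sum hold_def)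
qed

text \<open>The drift \<open>r\<close> disappears from symmetric double sums.\<close>

lemma P_symmetric_sum:
  assumes sym: "\<And>i j. \<phi> i j = \<phi> j i"
  shows "(\<Sum>i<n. \<Sum>j<n. P $$ (i, j) * \<phi> i j) = 2 * q\<^sub>c * (\<Sum>i<n. \<phi> i ((i + 1) mod n))
    + q\<^sub>l / d * (\<Sum>i<n. \<Sum>j<n. of_bool ({i, j} \<in> L) * \<phi> i j) + (\<Sum>i<n. hold i * \<phi> i i)"
proof -
  let ?B = "\<lambda>i j. if i = (j + 1) mod n then (q\<^sub>c - r) * \<phi> i j else 0"
  have "(\<Sum>i<n. \<Sum>j<n. P $$ (i, j) * \<phi> i j) =
      (\<Sum>i<n. \<Sum>j<n. (if j = (i + 1) mod n then (q\<^sub>c + r) * \<phi> i j else 0) + ?B i j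
        + q\<^sub>l / d * (of_bool ({i, j} \<in> L) * \<phi> i j) + (if i = j then hold i * \<phi> i j else 0))"
    by (intro sum.cong) (auto simp: P_entry hom_trans_def distrib_right)
  also have "\<dots> = (\<Sum>i<n. (q\<^sub>c + r) * \<phi> i ((i + 1) mod n)) + (\<Sum>i<n. \<Sum>j<n. ?B i j)
      + q\<^sub>l / d * (\<Sum>i<n. \<Sum>j<n. of_bool ({i, j} \<in> L) * \<phi> i j) + (\<Sum>i<n. hold i * \<phi> i i)"
    using n by (simp add: sum.distrib sum_distrib_left del: sum_of_bool_mult_eq sum_mult_of_bool_eq)
  also have "(\<Sum>i<n. \<Sum>j<n. ?B i j) = (\<Sum>i<n. (q\<^sub>c - r) * \<phi> i ((i + 1) mod n))"
    using n sym by (subst sum.swap) simp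
  finally have "(\<Sum>i<n. \<Sum>j<n. P $$ (i, j) * \<phi> i j) = (q\<^sub>c + r) * T + (q\<^sub>c - r) * T
      + q\<^sub>l / d * (\<Sum>i<n. \<Sum>j<n. of_bool ({i, j} \<in> L) * \<phi> i j) + (\<Sum>i<n. hold i * \<phi> i i)"
    if "T = (\<Sum>i<n. \<phi> i ((i + 1) mod n))" for T
    by (simp only: that sum_distrib_left)
  moreover have "(q\<^sub>c + r) * T + (q\<^sub>c - r) * T = 2 * q\<^sub>c * T" for T by (simp add: algebra_simps)
  ultimately show ?thesis by metis
qed

definition "edge_boundary S = (\<Sum>i<n. \<bar>of_bool (i \<in> S) - of_bool ((i + 1) mod n \<in> S)\<bar> :: real)
  + (\<Sum>i<n. \<Sum>j<n. of_bool ({i, j} \<in> L) * \<bar>of_bool (i \<in> S) - of_bool (j \<in> S)\<bar>) / 2"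

definition "\<kappa> = min q\<^sub>c q\<^sub>l"

lemma \<kappa>: "0 < \<kappa>" "\<kappa> \<le> q\<^sub>c" "\<kappa> \<le> q\<^sub>l" "\<kappa> \<le> 1"
  using pos le1 by (auto simp: \<kappa>_def)

lemma Poincare:
  assumes iso: "\<And>S. S \<subseteq> {..<n} \<Longrightarrow> 2 * card S \<le> n \<Longrightarrow> card S \<le> h * edge_boundary S" and h: "0 < h"
    and g: "(\<Sum>i<n. g i) = 0"
  shows "(\<kappa> / (d * h))\<^sup>2 * (\<Sum>i<n. (g i)\<^sup>2) \<le> (\<Sum>i<n. \<Sum>j<n. P $$ (i, j) * (g i - g j)\<^sup>2)"
proof (rule Cheeger)
  fix S assume S: "S \<subseteq> {..<n}" "2 * card S \<le> card {..<n}"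
  let ?\<phi> = "\<lambda>i j. \<bar>of_bool (i \<in> S) - of_bool (j \<in> S)\<bar> :: real"
  define b where "b = (\<Sum>i<n. ?\<phi> i ((i + 1) mod n))"
  define e where "e = (\<Sum>i<n. \<Sum>j<n. of_bool ({i, j} \<in> L) * ?\<phi> i j) / 2"
  have be: "0 \<le> b" "0 \<le> e" by (auto simp: b_def e_def intro!: sum_nonneg divide_nonneg_nonneg)
  have "2 * (\<kappa> / (d * h)) * card S \<le> 2 * (\<kappa> / (d * h)) * (h * (b + e))"
    using iso[of S] S \<kappa> h d by (intro mult_left_mono) (auto simp: edge_boundary_def b_def e_def)
  also have "\<dots> = 2 * (\<kappa> / d * b) + 2 * (\<kappa> / d * e)" using h d by (simp add: field_simps)
  also have "\<dots> \<le> 2 * (q\<^sub>c * b) + 2 * (q\<^sub>l / d * e)"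
  proof -
    have "\<kappa> / d \<le> \<kappa>" using d \<kappa> by (simp add: divide_le_eq mult_left_le mult_le_cancel_left1)
    then have "\<kappa> / d \<le> q\<^sub>c" using \<kappa> by linarith
    moreover have "\<kappa> / d \<le> q\<^sub>l / d" using d \<kappa> by (intro divide_right_mono) auto
    ultimately show ?thesis using be by (intro add_mono mult_left_mono mult_right_mono) auto
  qed
  also have "\<dots> = (\<Sum>i<n. \<Sum>j<n. P $$ (i, j) * ?\<phi> i j)"
    by (subst P_symmetric_sum) (auto simp: b_def e_def abs_minus_commute)
  finally show "2 * (\<kappa> / (d * h)) * card S \<le> (\<Sum>i<n. \<Sum>j<n. P $$ (i, j) * ?\<phi> i j)" .
qed (use doubly_stochastic_P g \<kappa> d h in \<open>auto simp: doubly_stochastic_def\<close>)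

lemma lazy_l2_contraction:
  assumes iso: "\<And>S. S \<subseteq> {..<n} \<Longrightarrow> 2 * card S \<le> n \<Longrightarrow> card S \<le> h * edge_boundary S" and h: "0 < h"
    and lazy: "lazy_chain P"
  shows "l2_contraction n P ((\<kappa> / (d * h))\<^sup>2 / 2)"
  unfolding l2_contraction_def
proof (intro allI impI)
  fix g :: "nat \<Rightarrow> real" assume g: "(\<Sum>i<n. g i) = 0"
  have dim: "dim_row P = n" by (simp add: hom_chain_def)
  have "(\<Sum>j<n. (\<Sum>i<n. P $$ (i, j) * g i)\<^sup>2)
      \<le> (\<Sum>i<n. (g i)\<^sup>2) - (\<Sum>i<n. \<Sum>j<n. P $$ (j, i) * (g i - g j)\<^sup>2) / 2"
    using doubly_stochastic_P lazy
    by (intro lazy_contraction[of "{..<n}" "\<lambda>i j. P $$ (j, i)"]) (auto simp: doubly_stochastic_def lazy_chain_def dim)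
  also have "(\<Sum>i<n. \<Sum>j<n. P $$ (j, i) * (g i - g j)\<^sup>2) = (\<Sum>i<n. \<Sum>j<n. P $$ (i, j) * (g i - g j)\<^sup>2)"
    by (subst sum.swap) (simp add: power2_commute)
  finally show "(\<Sum>j<n. (\<Sum>i<n. P $$ (i, j) * g i)\<^sup>2) \<le> (1 - (\<kappa> / (d * h))\<^sup>2 / 2) * (\<Sum>i<n. (g i)\<^sup>2)"
    using Poincare[OF iso h g] by (simp add: algebra_simps)
qed

text \<open>Along a run of nodes up to the next one without long range edges, which is kept in place with
  probability at least \<open>q\<^sub>l\<close>, the signs of \<open>g\<close> cannot alternate for free.\<close>

lemma no_alternation:
  fixes w :: nat
  assumes win: "\<And>x. x < n \<Longrightarrow> \<exists>s<w. long_degree L ((x + s) mod n) = 0"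
  shows "\<kappa> / w\<^sup>2 * (\<Sum>i<n. (g i)\<^sup>2) \<le> (\<Sum>i<n. \<Sum>j<n. P $$ (i, j) * (g i + g j)\<^sup>2)"
proof -
  have "0 < w" using win[of 0] n by auto
  define z :: "nat \<Rightarrow> real" where "z i = of_bool (long_degree L i = 0)" for i
  define D where "D y = \<bar>g y + g ((y + 1) mod n)\<bar> + z y * \<bar>g y\<bar>" for y
  define Q where "Q y = (g y + g ((y + 1) mod n))\<^sup>2 + z y * (g y)\<^sup>2" for y
  have D0: "0 \<le> D y" for y by (auto simp: D_def z_def)
  have DQ: "(D y)\<^sup>2 \<le> 2 * Q y" for y
  proof -
    have "(a + z y * b)\<^sup>2 \<le> 2 * (a\<^sup>2 + z y * b\<^sup>2)" for a b :: real
      using zero_le_power2[of "a - b"] by (auto simp: z_def power2_eq_square algebra_simps)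
    from this[of "\<bar>g y + g ((y + 1) mod n)\<bar>" "\<bar>g y\<bar>"] show ?thesis by (simp add: D_def Q_def)
  qed
  have run: "\<bar>g x\<bar> \<le> (\<Sum>t\<le>s. D ((x + t) mod n))" if "x < n" "long_degree L ((x + s) mod n) = 0" for x s
    using that
  proof (induction s arbitrary: x)
    case 0
    then show ?case by (simp add: D_def z_def)
  next
    case (Suc s)
    let ?y = "(x + 1) mod n"
    have "?y < n" using n by simp
    have e: "(?y + t) mod n = (x + Suc t) mod n" for t by (simp add: mod_add_left_eq)
    have "\<bar>g ?y\<bar> \<le> (\<Sum>t\<le>s. D ((?y + t) mod n))"
      using Suc.prems(2) e[of s] by (intro Suc.IH \<open>?y < n\<close>) simp
    moreover have "\<bar>g x\<bar> \<le> \<bar>g x + g ?y\<bar> + \<bar>g ?y\<bar>" by linarith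
    then have "\<bar>g x\<bar> \<le> D x + \<bar>g ?y\<bar>" by (simp add: D_def z_def)
    ultimately have "\<bar>g x\<bar> \<le> D (x mod n) + (\<Sum>t\<le>s. D ((x + Suc t) mod n))"
      using Suc.prems(1) by (simp only: e mod_less)
    then show ?case by (simp only: sum.atMost_Suc_shift add_0_right)
  qed
  have "(g x)\<^sup>2 \<le> 2 * w * (\<Sum>t<w. Q ((x + t) mod n))" if x: "x < n" for x
  proof -
    obtain s where s: "s < w" "long_degree L ((x + s) mod n) = 0" using win[OF x] by auto
    have "\<bar>g x\<bar> \<le> (\<Sum>t\<le>s. D ((x + t) mod n))" by (rule run[OF x s(2)])
    also have "\<dots> \<le> (\<Sum>t<w. D ((x + t) mod n))" using s D0 by (intro sum_mono2) auto
    finally have "\<bar>g x\<bar>\<^sup>2 \<le> (\<Sum>t<w. D ((x + t) mod n))\<^sup>2" by (intro power_mono) auto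
    also have "\<dots> \<le> w * (\<Sum>t<w. (D ((x + t) mod n))\<^sup>2)"
      using Cauchy_Schwarz_ineq_sum[of "\<lambda>_. 1" "\<lambda>t. D ((x + t) mod n)" "{..<w}"] by simp
    also have "\<dots> \<le> w * (\<Sum>t<w. 2 * Q ((x + t) mod n))"
      using DQ by (intro mult_left_mono sum_mono) auto
    finally show ?thesis by (simp add: sum_distrib_left[symmetric])
  qed
  then have "(\<Sum>x<n. (g x)\<^sup>2) \<le> (\<Sum>x<n. 2 * w * (\<Sum>t<w. Q ((x + t) mod n)))"
    by (intro sum_mono) auto
  also have "\<dots> = 2 * w * (\<Sum>t<w. \<Sum>x<n. Q ((x + t) mod n))"
    unfolding sum_distrib_left by (rule sum.swap)
  also have "\<dots> = 2 * w\<^sup>2 * (\<Sum>x<n. Q x)"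
    by (simp add: sum_cyclic_shift power2_eq_square)
  finally have "\<kappa> / w\<^sup>2 * (\<Sum>x<n. (g x)\<^sup>2) \<le> \<kappa> / w\<^sup>2 * (2 * w\<^sup>2 * (\<Sum>x<n. Q x))"
    using \<kappa> by (intro mult_left_mono) auto
  also have "\<dots> = (\<Sum>x<n. 2 * (\<kappa> * Q x))" using \<open>0 < w\<close> by (simp add: sum_distrib_left[symmetric])
  also have "\<dots> \<le> (\<Sum>x<n. 2 * (q\<^sub>c * (g x + g ((x + 1) mod n))\<^sup>2) + hold x * (g x + g x)\<^sup>2)"
  proof (rule sum_mono)
    fix x assume "x \<in> {..<n}"
    have "\<kappa> * (z x * (g x)\<^sup>2) \<le> 2 * (hold x * (g x)\<^sup>2)"
    proof (cases "long_degree L x = 0")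
      case True
      then have "\<kappa> \<le> 2 * hold x" using le1 \<kappa> by (simp add: hold_def)
      then show ?thesis using True mult_right_mono[of \<kappa> "2 * hold x" "(g x)\<^sup>2"] by (simp add: z_def)
    qed (use \<open>x \<in> {..<n}\<close> hold_nonneg in \<open>auto simp: z_def\<close>)
    moreover have "\<kappa> * (g x + g ((x + 1) mod n))\<^sup>2 \<le> q\<^sub>c * (g x + g ((x + 1) mod n))\<^sup>2"
      using \<kappa> by (intro mult_right_mono) auto
    moreover have "(g x + g x)\<^sup>2 = 4 * (g x)\<^sup>2" by (simp add: power2_eq_square)
    ultimately show "2 * (\<kappa> * Q x) \<le> 2 * (q\<^sub>c * (g x + g ((x + 1) mod n))\<^sup>2) + hold x * (g x + g x)\<^sup>2"
      unfolding Q_def by (simp add: distrib_left)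
  qed
  also have "\<dots> \<le> (\<Sum>x<n. 2 * (q\<^sub>c * (g x + g ((x + 1) mod n))\<^sup>2) + hold x * (g x + g x)\<^sup>2)
      + q\<^sub>l / d * (\<Sum>i<n. \<Sum>j<n. of_bool ({i, j} \<in> L) * (g i + g j)\<^sup>2)"
  proof -
    have "0 \<le> q\<^sub>l / d * (\<Sum>i<n. \<Sum>j<n. of_bool ({i, j} \<in> L) * (g i + g j)\<^sup>2)"
      using pos d by (intro mult_nonneg_nonneg sum_nonneg) auto
    then show ?thesis by linarith
  qed
  also have "\<dots> = (\<Sum>i<n. \<Sum>j<n. P $$ (i, j) * (g i + g j)\<^sup>2)"
    by (subst P_symmetric_sum) (auto simp: add.commute sum.distrib sum_distrib_left mult.assoc)
  finally show ?thesis .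
qed

lemma reversible_l2_contraction:
  fixes w :: nat
  assumes iso: "\<And>S. S \<subseteq> {..<n} \<Longrightarrow> 2 * card S \<le> n \<Longrightarrow> card S \<le> h * edge_boundary S" and h: "0 < h"
    and win: "\<And>x. x < n \<Longrightarrow> \<exists>s<w. long_degree L ((x + s) mod n) = 0"
    and "r = 0" and small: "(\<kappa> / (d * h))\<^sup>2 \<le> \<kappa> / w\<^sup>2"
  shows "l2_contraction n P ((\<kappa> / (d * h))\<^sup>2 / 2)"
  unfolding l2_contraction_def
proof (intro allI impI)
  fix g :: "nat \<Rightarrow> real" assume g: "(\<Sum>i<n. g i) = 0"
  have "0 < w" using win[of 0] n by auto
  have sym: "P $$ (i, j) = P $$ (j, i)" if "i < n" "j < n" for i j
    using P_entry[OF that] P_entry[OF that(2,1)] hom_trans_reverse[of n L q\<^sub>c q\<^sub>l r d j i] \<open>r = 0\<close>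
    by auto
  have "\<kappa> / w\<^sup>2 \<le> 1" using \<kappa> \<open>0 < w\<close> power2_nat_le_eq_le[of 1 w]
    by (auto simp: divide_le_eq intro: order_trans)
  have "(\<Sum>j<n. (\<Sum>i<n. P $$ (j, i) * g i)\<^sup>2) \<le> (1 - (\<kappa> / (d * h))\<^sup>2 / 2) * (\<Sum>i<n. (g i)\<^sup>2)"
  proof (rule symmetric_contraction)
    fix f :: "nat \<Rightarrow> real" assume f: "(\<Sum>i<n. f i) = 0"
    show "2 * ((\<kappa> / (d * h))\<^sup>2 / 2) * (\<Sum>i<n. (f i)\<^sup>2) \<le> (\<Sum>i<n. \<Sum>j<n. P $$ (i, j) * (f i - f j)\<^sup>2)"
      using Poincare[OF iso h f] by simp
    have "(\<kappa> / (d * h))\<^sup>2 * (\<Sum>i<n. (f i)\<^sup>2) \<le> \<kappa> / w\<^sup>2 * (\<Sum>i<n. (f i)\<^sup>2)"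
      using small by (intro mult_right_mono sum_nonneg) auto
    also have "\<dots> \<le> (\<Sum>i<n. \<Sum>j<n. P $$ (i, j) * (f i + f j)\<^sup>2)" by (rule no_alternation[OF win])
    finally show "2 * ((\<kappa> / (d * h))\<^sup>2 / 2) * (\<Sum>i<n. (f i)\<^sup>2) \<le> \<dots>" by simp
  qed (use doubly_stochastic_P sym g small \<open>\<kappa> / w\<^sup>2 \<le> 1\<close> in \<open>auto simp: doubly_stochastic_def\<close>)
  moreover have "(\<Sum>j<n. (\<Sum>i<n. P $$ (i, j) * g i)\<^sup>2) = (\<Sum>j<n. (\<Sum>i<n. P $$ (j, i) * g i)\<^sup>2)"
    by (intro sum.cong refl arg_cong[where f = "\<lambda>x. x\<^sup>2"]) (simp add: sym)
  ultimately show "(\<Sum>j<n. (\<Sum>i<n. P $$ (i, j) * g i)\<^sup>2) \<le> (1 - (\<kappa> / (d * h))\<^sup>2 / 2) * (\<Sum>i<n. (g i)\<^sup>2)"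
    by simp
qed

end

section \<open>Isoperimetry from block expansion\<close>

definition block :: "nat \<Rightarrow> nat \<Rightarrow> nat \<Rightarrow> nat" where
  "block n l x = min (x div l) (n div l - 1)"

lemma block_less: "0 < l \<Longrightarrow> l \<le> n \<Longrightarrow> block n l x < n div l"
  by (auto simp: block_def min_def div_greater_zero_iff intro: le_less_trans)

lemma block_mono: "x \<le> y \<Longrightarrow> block n l x \<le> block n l y"
  unfolding block_def by (intro min.mono div_le_mono) auto

lemma card_block_le:
  assumes "0 < l" "l \<le> n"
  shows "card {x\<in>{..<n}. block n l x = k} \<le> 2 * l"
proof -
  have "{x\<in>{..<n}. block n l x = k} \<subseteq> {k * l..<k * l + 2 * l}"
  proof
    fix x assume "x \<in> {x\<in>{..<n}. block n l x = k}"
    then have x: "x < n" "min (x div l) (n div l - 1) = k" by (auto simp: block_def)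
    have "x div l \<le> n div l" using x by (intro div_le_mono) auto
    then have "k \<le> x div l" "x div l \<le> k + 1" using x by (auto simp: min_def split: if_splits)
    then have "k * l \<le> x div l * l" "x div l * l \<le> (k + 1) * l" by (intro mult_le_mono1; simp)+
    moreover have "x = x div l * l + x mod l" "x mod l < l" using assms by auto
    ultimately have "k * l \<le> x" "x < (k + 1) * l + l" by linarith+
    then show "x \<in> {k * l..<k * l + 2 * l}" by simp
  qed
  then show ?thesis using card_mono[of "{k * l..<k * l + 2 * l}"] by simp
qed

lemma card_block_ge:
  assumes "0 < l" "k < n div l"
  shows "l \<le> card {x\<in>{..<n}. block n l x = k}"
proof -
  have "{k * l..<k * l + l} \<subseteq> {x\<in>{..<n}. block n l x = k}"
  proof
    fix x assume x: "x \<in> {k * l..<k * l + l}"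
    have "(k + 1) * l \<le> n div l * l" using assms by (intro mult_right_mono) auto
    also have "\<dots> \<le> n" by simp
    finally have "x < n" using x by (simp add: algebra_simps)
    moreover have "x div l = k" using x by (intro div_nat_eqI) (auto simp: algebra_simps)
    ultimately show "x \<in> {x\<in>{..<n}. block n l x = k}" using assms by (simp add: block_def)
  qed
  from card_mono[OF _ this] show ?thesis by simp
qed

lemma change_between:
  fixes a b :: nat
  assumes "a < b" "Q a \<noteq> Q b"
  shows "\<exists>z\<ge>a. z < b \<and> Q z \<noteq> Q (Suc z)"
  using assms
proof (induction b)
  case (Suc b)
  show ?case
  proof (cases "Q b = Q (Suc b)")
    case True
    then have "a < b" using Suc.prems by (metis less_antisym)
    then show ?thesis using Suc True less_SucI by metis
  next
    case False
    then show ?thesis using Suc.prems by (intro exI[of _ b]) auto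
  qed
qed simp

definition block_expanding :: "nat \<Rightarrow> nat \<Rightarrow> nat set set \<Rightarrow> bool" where
  "block_expanding n l L \<longleftrightarrow> (\<forall>U V. U \<subseteq> {..<n div l} \<longrightarrow> V \<subseteq> {..<n div l} \<longrightarrow> U \<inter> V = {} \<longrightarrow> U \<noteq> {} \<longrightarrow>
     n div l \<le> 8 * card V \<longrightarrow> n div l \<le> 2 * card U + card V \<longrightarrow>
     (\<exists>i<n. \<exists>j<n. block n l i \<in> U \<and> block n l j \<in> V \<and> {i, j} \<in> L))"

context long_range
begin

text \<open>Blocks met by both \<open>S\<close> and its complement cost a cycle edge each. If few long range edges
  leave \<open>S\<close>, discarding the blocks they start from leaves a set of blocks contradicting
  expansion.\<close>

lemma isoperimetry:
  assumes exp: "block_expanding n l L" and l: "0 < l" "l \<le> n" and S: "S \<subseteq> {..<n}" "2 * card S \<le> n"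
  shows "card S \<le> 32 * l * edge_boundary S"
proof -
  define m where "m = n div l"
  define fib where "fib k = {x\<in>{..<n}. block n l x = k}" for k
  define U where "U = {k\<in>{..<m}. fib k \<subseteq> S}"
  define V where "V = {k\<in>{..<m}. fib k \<inter> S = {}}"
  define M where "M = {..<m} - U - V"
  define C where "C = {x\<in>{..<n}. (x \<in> S) \<noteq> ((x + 1) mod n \<in> S)}"
  define E where "E = {(i, j). i \<in> S \<and> j \<in> {..<n} - S \<and> {i, j} \<in> L}"
  have fin: "finite U" "finite V" "finite M" "finite C" "finite S"
    using S finite_subset by (auto simp: U_def V_def M_def C_def)
  have "finite E" by (rule finite_subset[of _ "S \<times> {..<n}"]) (use fin in \<open>auto simp: E_def\<close>)
  have m_pos: "0 < m" using l by (simp add: m_def div_greater_zero_iff)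
  have fib_ne: "fib k \<noteq> {}" if "k < m" for k
  proof -
    have "l \<le> card (fib k)" using card_block_ge[OF l(1)] that unfolding fib_def m_def by blast
    then show ?thesis using l by auto
  qed
  have disj: "U \<inter> V = {}" using fib_ne by (auto simp: U_def V_def)
  have part: "m = card U + card M + card V"
  proof -
    have "{..<m} = U \<union> V \<union> M" by (auto simp: M_def U_def V_def)
    moreover have "card (U \<union> V \<union> M) = card (U \<union> V) + card M"
      by (rule card_Un_disjoint) (use fin in \<open>auto simp: M_def\<close>)
    moreover have "card (U \<union> V) = card U + card V" using fin disj by (intro card_Un_disjoint)
    ultimately show ?thesis by (metis add.assoc add.commute card_lessThan)
  qed
  have covered: "card A \<le> 2 * l * card K" if "A \<subseteq> {..<n}" "\<And>x. x \<in> A \<Longrightarrow> block n l x \<in> K" "finite K" for A K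
  proof -
    have "A \<subseteq> (\<Union>k\<in>K. fib k)" using that by (auto simp: fib_def)
    then have "card A \<le> card (\<Union>k\<in>K. fib k)"
      by (rule card_mono[rotated]) (use that in \<open>auto simp: fib_def\<close>)
    also have "\<dots> \<le> (\<Sum>k\<in>K. card (fib k))" by (rule card_UN_le[OF that(3)])
    also have "\<dots> \<le> (\<Sum>k\<in>K. 2 * l)" unfolding fib_def by (intro sum_mono card_block_le l)
    finally show ?thesis by (simp add: mult.commute)
  qed
  have S_le: "card S \<le> 2 * l * (card U + card M)"
  proof -
    have "card S \<le> 2 * l * card (U \<union> M)"
      using S fin block_less[OF l] by (intro covered) (auto simp: M_def U_def V_def fib_def m_def)
    then show ?thesis using card_Un_le[of U M] by (meson le_trans mult_le_mono2)
  qed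
  have Sc_le: "card ({..<n} - S) \<le> 2 * l * (card V + card M)"
  proof -
    have "card ({..<n} - S) \<le> 2 * l * card (V \<union> M)"
      using S fin block_less[OF l] by (intro covered) (auto simp: M_def U_def V_def fib_def m_def)
    then show ?thesis using card_Un_le[of V M] by (meson le_trans mult_le_mono2)
  qed
  have "card M \<le> card C"
  proof -
    have "M \<subseteq> block n l ` C"
    proof
      fix k assume k: "k \<in> M"
      then obtain x y where xy: "x \<in> fib k" "x \<notin> S" "y \<in> fib k" "y \<in> S" by (auto simp: M_def U_def V_def)
      then have "min x y < max x y" "(min x y \<in> S) \<noteq> (max x y \<in> S)"
        by (auto simp: min_def max_def) (metis nat_neq_iff not_le)+
      from change_between[of _ _ "\<lambda>x. x \<in> S", OF this]
      obtain z where z: "min x y \<le> z" "z < max x y" "(z \<in> S) \<noteq> (Suc z \<in> S)" by auto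
      have "min x y \<in> fib k" "max x y \<in> fib k" using xy by (auto simp: min_def max_def)
      then have "block n l z = k" "Suc z < n"
        using block_mono[of "min x y" z n l] block_mono[of z "max x y" n l] z by (auto simp: fib_def)
      then have "z \<in> C" using z by (simp add: C_def)
      with \<open>block n l z = k\<close> show "k \<in> block n l ` C" by auto
    qed
    then have "card M \<le> card (block n l ` C)" using fin by (intro card_mono) auto
    also have "\<dots> \<le> card C" using fin by (intro card_image_le)
    finally show ?thesis .
  qed
  have bd: "edge_boundary S = card C + card E"
  proof -
    have "(\<Sum>i<n. \<bar>of_bool (i \<in> S) - of_bool ((i + 1) mod n \<in> S)\<bar>) = (\<Sum>i<n. of_bool (i \<in> C) :: real)"
      by (intro sum.cong) (auto simp: C_def)
    moreover have "{..<n} \<inter> C = C" by (auto simp: C_def)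
    moreover have "(\<Sum>i<n. \<Sum>j<n. of_bool ({i, j} \<in> L) * \<bar>of_bool (i \<in> S) - of_bool (j \<in> S)\<bar>) / 2 = real (card E)"
    proof -
      have "(\<Sum>i<n. \<Sum>j<n. of_bool ({i, j} \<in> L) * \<bar>of_bool (i \<in> S) - of_bool (j \<in> S)\<bar>)
         = (\<Sum>i<n. \<Sum>j<n. of_bool ((i, j) \<in> E) + of_bool ((j, i) \<in> E) :: real)"
        by (intro sum.cong) (auto simp: E_def insert_commute)
      also have "\<dots> = 2 * (\<Sum>i<n. \<Sum>j<n. of_bool ((i, j) \<in> E))"
        unfolding sum.distrib by (subst (2) sum.swap) simp
      also have "(\<Sum>i<n. \<Sum>j<n. of_bool ((i, j) \<in> E)) = (\<Sum>p\<in>{..<n} \<times> {..<n}. of_bool (p \<in> E) :: real)"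
        unfolding sum.cartesian_product by (intro sum.cong) auto
      also have "\<dots> = real (card E)"
      proof -
        have "E \<subseteq> {..<n} \<times> {..<n}" using S by (auto simp: E_def)
        then show ?thesis by (simp add: Int_absorb1)
      qed
      finally show ?thesis by simp
    qed
    ultimately show ?thesis by (simp add: edge_boundary_def)
  qed
  have key: "card U + card M \<le> 16 * (card C + card E)"
  proof (rule ccontr)
    assume "\<not> ?thesis"
    then have small: "15 * card C + 16 * card E < card U" using \<open>card M \<le> card C\<close> unfolding distrib_left by linarith
    define F where "F = block n l ` fst ` E"
    have "finite F" using \<open>finite E\<close> by (simp add: F_def)
    have "card F \<le> card E"
      using card_image_le[of "fst ` E" "block n l"] card_image_le[of E fst] \<open>finite E\<close> by (simp add: F_def)
    define U' where "U' = U - F"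
    have U': "card U \<le> card U' + card E"
      using diff_card_le_card_Diff[OF \<open>finite F\<close>, of U] \<open>card F \<le> card E\<close> by (simp add: U'_def)
    have "n \<le> 2 * card ({..<n} - S)" using S fin by (simp add: card_Diff_subset)
    moreover have "m * l \<le> n" by (simp add: m_def)
    ultimately have "m * l \<le> (4 * (card V + card M)) * l" using Sc_le by (simp add: algebra_simps)
    then have "m \<le> 4 * (card V + card M)" using l by simp
    have arith: "m \<le> 8 * v \<and> m \<le> 2 * u' + v"
      if "m \<le> 4 * (v + w)" "m = u + w + v" "15 * c + 16 * e < u" "w \<le> c" "u \<le> u' + e" for m u u' v w c e :: nat
      using that unfolding distrib_left by (cases "m \<le> 8 * v") linarith+
    have "m \<le> 8 * card V \<and> m \<le> 2 * card U' + card V"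
      by (rule arith[OF \<open>m \<le> 4 * (card V + card M)\<close> part small \<open>card M \<le> card C\<close> U'])
    then have "m \<le> 8 * card V" "m \<le> 2 * card U' + card V" by blast+
    moreover have "U' \<subseteq> {..<m}" "V \<subseteq> {..<m}" "U' \<inter> V = {}" using disj by (auto simp: U'_def U_def V_def)
    moreover have "U' \<noteq> {}" using U' small by auto
    ultimately obtain i j where ij: "i < n" "j < n" "block n l i \<in> U'" "block n l j \<in> V" "{i, j} \<in> L"
      using exp unfolding block_expanding_def m_def by blast
    then have "i \<in> S" "j \<notin> S" by (auto simp: U'_def U_def V_def fib_def)
    then have "(i, j) \<in> E" using ij by (simp add: E_def)
    then have "block n l i \<in> F" unfolding F_def by (metis fst_conv image_eqI)
    then show False using ij by (simp add: U'_def)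
  qed
  have "card S \<le> 2 * l * (16 * (card C + card E))"
    using S_le mult_le_mono2[OF key, of "2 * l"] by linarith
  then have "real (card S) \<le> real (2 * l * (16 * (card C + card E)))" by (simp only: of_nat_le_iff)
  then show ?thesis by (simp add: bd algebra_simps)
qed

end

section \<open>The random graph\<close>

lemma finite_node_pairs: "finite (node_pairs n)"
  by (rule finite_subset[of _ "Pow {..<n}"]) (auto simp: node_pairs_def)

lemma set_pmf_M3: "set_pmf (M3 \<alpha> n) \<subseteq> Pow (node_pairs n)"
  by (auto simp: M3_def)

lemma prob_M3_avoid:
  assumes p: "p = 2 * real n powr (- \<alpha>)" "p \<le> 1" and B: "B \<subseteq> node_pairs n"
  shows "measure_pmf.prob (M3 \<alpha> n) {L. L \<inter> B = {}} = (1 - p) ^ card B"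
proof -
  let ?b = "bernoulli_pmf (2 * real n powr (- \<alpha>))"
  have "(\<lambda>f. {e \<in> node_pairs n. f e}) -` {L. L \<inter> B = {}}
      = Pi (node_pairs n) (\<lambda>e. if e \<in> B then {False} else UNIV)"
    using B by (auto simp: Pi_def)
  then have "measure_pmf.prob (M3 \<alpha> n) {L. L \<inter> B = {}}
      = (\<Prod>e\<in>node_pairs n. measure_pmf.prob ?b (if e \<in> B then {False} else UNIV))"
    unfolding M3_def measure_map_pmf by (simp only: measure_Pi_pmf_Pi[OF finite_node_pairs])
  also have "\<dots> = (\<Prod>e\<in>node_pairs n. if e \<in> B then 1 - p else 1)"
    using p by (intro prod.cong) (auto simp: measure_pmf_single)
  also have "\<dots> = (1 - p) ^ card B"
    using B by (simp add: prod.If_cases finite_node_pairs Int_absorb1)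
  finally show ?thesis .
qed

lemma prob_M3_contain:
  assumes p: "p = 2 * real n powr (- \<alpha>)" "p \<le> 1" and B: "B \<subseteq> node_pairs n"
  shows "measure_pmf.prob (M3 \<alpha> n) {L. B \<subseteq> L} = p ^ card B"
proof -
  let ?b = "bernoulli_pmf (2 * real n powr (- \<alpha>))"
  have "(\<lambda>f. {e \<in> node_pairs n. f e}) -` {L. B \<subseteq> L}
      = Pi (node_pairs n) (\<lambda>e. if e \<in> B then {True} else UNIV)"
    using B by (auto simp: Pi_def)
  then have "measure_pmf.prob (M3 \<alpha> n) {L. B \<subseteq> L}
      = (\<Prod>e\<in>node_pairs n. measure_pmf.prob ?b (if e \<in> B then {True} else UNIV))"
    unfolding M3_def measure_map_pmf by (simp only: measure_Pi_pmf_Pi[OF finite_node_pairs])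
  also have "\<dots> = (\<Prod>e\<in>node_pairs n. if e \<in> B then p else 1)"
    using p by (intro prod.cong) (auto simp: measure_pmf_single)
  also have "\<dots> = p ^ card B"
    using B by (simp add: prod.If_cases finite_node_pairs Int_absorb1)
  finally show ?thesis .
qed

lemma sum_Pow_power_card:
  fixes x :: "'a :: comm_semiring_1"
  assumes "finite A"
  shows "(\<Sum>U\<in>Pow A. x ^ card U) = (1 + x) ^ card A"
  using prod_add[OF assms, of "\<lambda>_. x" "\<lambda>_. 1"] assms by (simp add: add.commute)

lemma prob_not_expanding:
  assumes p: "p = 2 * real n powr (- \<alpha>)" "p \<le> 1" and l: "0 < l" "l \<le> n"
    and big: "32 * ln n \<le> p * l\<^sup>2 * (n div l)"
  shows "measure_pmf.prob (M3 \<alpha> n) {L. \<not> block_expanding n l L} \<le> (exp (1 / n) - 1) * exp (1 / n)"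
proof -
  define m where "m = n div l"
  define B where "B U V = (\<lambda>(i, j). {i, j}) ` ({i\<in>{..<n}. block n l i \<in> U} \<times> {j\<in>{..<n}. block n l j \<in> V})"
    for U V
  define V where "V U W = {..<m} - U - W" for U W
  define ok where "ok U W \<longleftrightarrow> m \<le> 8 * card (V U W) \<and> card W \<le> card U \<and> U \<inter> W = {}" for U W
  define bad where "bad U W = {L. ok U W \<and> L \<inter> B U (V U W) = {}}" for U W
  define x where "x = 1 / (real n)\<^sup>2"
  have n: "1 \<le> n" using l by simp
  have fib: "l * card U \<le> card {i\<in>{..<n}. block n l i \<in> U}" if U: "U \<subseteq> {..<m}" for U
  proof -
    have fin: "finite U" using U finite_subset by blast
    have "card {i\<in>{..<n}. block n l i \<in> U} = card (\<Union>k\<in>U. {i\<in>{..<n}. block n l i = k})"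
      by (intro arg_cong[where f = card]) auto
    also have "\<dots> = (\<Sum>k\<in>U. card {i\<in>{..<n}. block n l i = k})"
      using fin by (intro card_UN_disjoint) auto
    also have "\<dots> \<ge> (\<Sum>k\<in>U. l)"
      using U unfolding m_def by (intro sum_mono card_block_ge l) auto
    finally show ?thesis by (simp add: mult.commute)
  qed
  have prob_bad: "measure_pmf.prob (M3 \<alpha> n) (bad U W) \<le> x ^ card U * x ^ card W"
    if U: "U \<subseteq> {..<m}" and W: "W \<subseteq> {..<m}" for U W
  proof (cases "ok U W")
    case False
    then show ?thesis by (simp add: bad_def x_def)
  next
    case True
    have sub: "B U (V U W) \<subseteq> node_pairs n"
      by (auto simp: B_def V_def node_pairs_def card_2_iff)
    have "l * card U * (l * card (V U W)) \<le> card (B U (V U W))"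
    proof -
      have "inj_on (\<lambda>(i, j). {i, j}) ({i\<in>{..<n}. block n l i \<in> U} \<times> {j\<in>{..<n}. block n l j \<in> V U W})"
        by (auto simp: inj_on_def V_def doubleton_eq_iff)
      then show ?thesis unfolding B_def
        by (simp only: card_image card_cartesian_product mult_le_mono fib U V_def Diff_subset subset_trans[OF Diff_subset Diff_subset])
    qed
    then have cB: "real l * card U * (l * card (V U W)) \<le> card (B U (V U W))"
      by (metis of_nat_le_iff of_nat_mult)
    have "4 * ln n * card U \<le> (p * l\<^sup>2 * m) / 8 * card U"
      using big by (intro mult_right_mono) (auto simp: m_def)
    also have "\<dots> \<le> (p * l\<^sup>2 * (8 * card (V U W))) / 8 * card U"
      using True p by (intro mult_right_mono divide_right_mono mult_left_mono) (auto simp: ok_def)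
    also have "\<dots> = p * (real l * card U * (l * card (V U W)))" by (simp add: power2_eq_square)
    also have "\<dots> \<le> p * card (B U (V U W))" using cB p by (intro mult_left_mono) auto
    finally have 1: "4 * ln n * card U \<le> p * card (B U (V U W))" .
    have "measure_pmf.prob (M3 \<alpha> n) (bad U W) = (1 - p) ^ card (B U (V U W))"
      using True prob_M3_avoid[OF p sub] by (simp add: bad_def)
    also have "\<dots> \<le> exp (- p) ^ card (B U (V U W))"
      using p exp_ge_add_one_self[of "- p"] by (intro power_mono) auto
    also have "\<dots> = exp (- (p * card (B U (V U W))))"
      by (simp add: exp_of_nat_mult[symmetric] mult.commute)
    also have "\<dots> \<le> exp (- (4 * ln n * card U))" using 1 by simp
    also have "\<dots> = (1 / real n) ^ (4 * card U)"
    proof -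
      have "exp (- (4 * ln n * card U)) = exp (real (4 * card U) * (- ln n))" by (simp add: mult.commute)
      also have "\<dots> = exp (- ln n) ^ (4 * card U)" by (rule exp_of_nat_mult)
      also have "exp (- ln n) = 1 / real n" using n by (simp add: exp_minus divide_inverse)
      finally show ?thesis .
    qed
    also have "\<dots> \<le> (1 / real n) ^ (2 * card U + 2 * card W)"
      using n True by (intro power_decreasing) (auto simp: ok_def)
    also have "\<dots> = x ^ card U * x ^ card W"
      by (simp add: x_def power_add power_mult power_one_over)
    finally show ?thesis .
  qed
  have "{L. \<not> block_expanding n l L} \<subseteq> (\<Union>U\<in>Pow {..<m} - {{}}. \<Union>W\<in>Pow {..<m}. bad U W)"
  proof
    fix L assume "L \<in> {L. \<not> block_expanding n l L}"
    then obtain U Y where UY: "U \<subseteq> {..<m}" "Y \<subseteq> {..<m}" "U \<inter> Y = {}" "U \<noteq> {}"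
       "m \<le> 8 * card Y" "m \<le> 2 * card U + card Y"
       "\<And>i j. i < n \<Longrightarrow> j < n \<Longrightarrow> block n l i \<in> U \<Longrightarrow> block n l j \<in> Y \<Longrightarrow> {i, j} \<notin> L"
      unfolding block_expanding_def m_def by blast
    define W where "W = {..<m} - U - Y"
    have fin: "finite U" "finite Y" using UY finite_subset by blast+
    have VY: "V U W = Y" using UY by (auto simp: V_def W_def)
    have "W = {..<m} - (U \<union> Y)" by (auto simp: W_def)
    then have "card W = m - card (U \<union> Y)"
      using UY fin by (simp add: card_Diff_subset)
    also have "card (U \<union> Y) = card U + card Y" using UY fin by (intro card_Un_disjoint)
    finally have "card W \<le> card U" using UY by linarith
    moreover have "L \<inter> B U Y = {}" using UY(7) by (auto simp: B_def)
    moreover have "U \<inter> W = {}" by (auto simp: W_def)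
    ultimately have "L \<in> bad U W" using UY by (simp add: bad_def ok_def VY)
    moreover have "W \<in> Pow {..<m}" by (auto simp: W_def)
    ultimately show "L \<in> (\<Union>U\<in>Pow {..<m} - {{}}. \<Union>W\<in>Pow {..<m}. bad U W)" using UY by blast
  qed
  then have "measure_pmf.prob (M3 \<alpha> n) {L. \<not> block_expanding n l L}
     \<le> measure_pmf.prob (M3 \<alpha> n) (\<Union>U\<in>Pow {..<m} - {{}}. \<Union>W\<in>Pow {..<m}. bad U W)"
    by (intro measure_pmf.finite_measure_mono) auto
  also have "\<dots> \<le> (\<Sum>U\<in>Pow {..<m} - {{}}. measure_pmf.prob (M3 \<alpha> n) (\<Union>W\<in>Pow {..<m}. bad U W))"
    by (intro measure_pmf.finite_measure_subadditive_finite) auto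
  also have "\<dots> \<le> (\<Sum>U\<in>Pow {..<m} - {{}}. \<Sum>W\<in>Pow {..<m}. measure_pmf.prob (M3 \<alpha> n) (bad U W))"
    by (intro sum_mono measure_pmf.finite_measure_subadditive_finite) auto
  also have "\<dots> \<le> (\<Sum>U\<in>Pow {..<m} - {{}}. \<Sum>W\<in>Pow {..<m}. x ^ card U * x ^ card W)"
    by (intro sum_mono prob_bad) auto
  also have "\<dots> = (\<Sum>U\<in>Pow {..<m} - {{}}. x ^ card U) * (\<Sum>W\<in>Pow {..<m}. x ^ card W)"
    by (simp add: sum_product)
  also have "\<dots> = ((1 + x) ^ m - 1) * (1 + x) ^ m"
    by (simp add: sum_diff1 sum_Pow_power_card)
  also have "\<dots> \<le> (exp (1 / n) - 1) * exp (1 / n)"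
  proof -
    have "(1 + x) ^ m \<le> exp x ^ m" using exp_ge_add_one_self[of x] by (intro power_mono) (auto simp: x_def)
    also have "\<dots> = exp (m * x)" by (simp add: exp_of_nat_mult)
    also have "m * x \<le> n * x" by (intro mult_right_mono) (auto simp: x_def m_def)
    then have "exp (m * x) \<le> exp (1 / n)" using n by (simp add: x_def power2_eq_square)
    finally have "(1 + x) ^ m \<le> exp (1 / n)" .
    then show ?thesis by (intro mult_mono) (auto simp: x_def)
  qed
  finally show ?thesis .
qed

lemma second_moment:
  fixes M :: "'a pmf" and A :: "'i \<Rightarrow> 'a set"
  assumes I: "finite I" and \<mu>: "\<mu> = (\<Sum>k\<in>I. measure_pmf.prob M (A k))" "0 < \<mu>" and "0 \<le> \<delta>"
    and corr: "\<And>j k. j \<in> I \<Longrightarrow> k \<in> I \<Longrightarrow> j \<noteq> k \<Longrightarrow>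
      measure_pmf.prob M (A j \<inter> A k) \<le> (1 + \<delta>) * measure_pmf.prob M (A j) * measure_pmf.prob M (A k)"
  shows "measure_pmf.prob M {x. \<forall>k\<in>I. x \<notin> A k} \<le> 1 / \<mu> + \<delta>"
proof -
  let ?P = "measure_pmf.prob M" and ?E = "measure_pmf.expectation M"
  have ind: "integrable (measure_pmf M) (indicator B :: 'a \<Rightarrow> real)" for B
    by (intro integrable_real_indicator) (auto simp: measure_pmf.emeasure_eq_measure)
  define X where "X x = (\<Sum>k\<in>I. indicator (A k) x :: real)" for x
  have X2: "(X x)\<^sup>2 = (\<Sum>j\<in>I. \<Sum>k\<in>I. indicator (A j \<inter> A k) x)" for x
    by (simp add: X_def power2_eq_square sum_product indicator_inter_arith)
  have int: "integrable (measure_pmf M) X" "integrable (measure_pmf M) (\<lambda>x. (X x)\<^sup>2)"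
    unfolding X2 unfolding X_def by (intro Bochner_Integration.integrable_sum ind)+
  have EX: "?E X = \<mu>"
    unfolding X_def by (subst Bochner_Integration.integral_sum) (auto simp: ind \<mu>)
  have "?E (\<lambda>x. (X x)\<^sup>2) = (\<Sum>j\<in>I. \<Sum>k\<in>I. ?P (A j \<inter> A k))"
    unfolding X2 by (subst Bochner_Integration.integral_sum | simp add: ind)+
  also have "\<dots> \<le> (\<Sum>j\<in>I. \<Sum>k\<in>I. of_bool (j = k) * ?P (A j) + (1 + \<delta>) * ?P (A j) * ?P (A k))"
  proof (intro sum_mono)
    fix j k assume "j \<in> I" "k \<in> I"
    then show "?P (A j \<inter> A k) \<le> of_bool (j = k) * ?P (A j) + (1 + \<delta>) * ?P (A j) * ?P (A k)"
      using corr[of j k] \<open>0 \<le> \<delta>\<close> by (cases "j = k") auto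
  qed
  also have "\<dots> = (\<Sum>j\<in>I. \<Sum>k\<in>I. of_bool (j = k) * ?P (A j)) + (1 + \<delta>) * \<mu> * \<mu>"
    by (simp add: sum.distrib sum_distrib_left[symmetric] sum_distrib_right[symmetric] \<mu>(1)[symmetric]
      del: sum_mult_of_bool_eq sum_of_bool_mult_eq)
  also have "(\<Sum>j\<in>I. \<Sum>k\<in>I. of_bool (j = k) * ?P (A j)) = \<mu>"
  proof -
    have "(\<Sum>k\<in>I. of_bool (j = k) * ?P (A j)) = ?P (A j)" if "j \<in> I" for j
    proof -
      have "(\<Sum>k\<in>I. of_bool (j = k) * ?P (A j)) = (\<Sum>k\<in>I. if j = k then ?P (A j) else 0)"
        by (intro sum.cong) auto
      then show ?thesis using I that by simp
    qed
    then show ?thesis by (simp add: \<mu>)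
  qed
  finally have E2: "?E (\<lambda>x. (X x)\<^sup>2) \<le> \<mu> + (1 + \<delta>) * \<mu> * \<mu>" .
  have "\<mu>\<^sup>2 * ?P {x. \<forall>k\<in>I. x \<notin> A k} = ?E (\<lambda>x. \<mu>\<^sup>2 * indicator {x. \<forall>k\<in>I. x \<notin> A k} x)" by simp
  also have "\<dots> \<le> ?E (\<lambda>x. (X x)\<^sup>2 - 2 * \<mu> * X x + \<mu>\<^sup>2)"
  proof (rule integral_mono)
    fix x
    have "(X x)\<^sup>2 - 2 * \<mu> * X x + \<mu>\<^sup>2 = (X x - \<mu>)\<^sup>2" by (simp add: power2_eq_square algebra_simps)
    moreover have "X x = 0" if "\<forall>k\<in>I. x \<notin> A k" using that by (simp add: X_def)
    ultimately show "\<mu>\<^sup>2 * indicator {x. \<forall>k\<in>I. x \<notin> A k} x \<le> (X x)\<^sup>2 - 2 * \<mu> * X x + \<mu>\<^sup>2"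
      by (auto simp: indicator_def)
  qed (intro Bochner_Integration.integrable_add Bochner_Integration.integrable_diff
       integrable_mult_right int ind; simp)+
  also have "\<dots> = ?E (\<lambda>x. (X x)\<^sup>2) - 2 * \<mu> * ?E X + \<mu>\<^sup>2" using int by simp
  also have "\<dots> \<le> \<mu> + \<delta> * \<mu>\<^sup>2" using E2 by (simp add: EX power2_eq_square algebra_simps)
  finally have "?P {x. \<forall>k\<in>I. x \<notin> A k} \<le> (\<mu> + \<delta> * \<mu>\<^sup>2) / \<mu>\<^sup>2"
    using \<mu>(2) by (simp add: pos_le_divide_eq mult.commute)
  also have "\<dots> = 1 / \<mu> + \<delta>" using \<mu>(2) by (simp add: field_simps power2_eq_square)
  finally show ?thesis .
qed

definition degree_free :: "nat set set \<Rightarrow> nat set \<Rightarrow> bool" where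
  "degree_free L T \<longleftrightarrow> (\<forall>x\<in>T. long_degree L x = 0)"

lemma degree_free_iff:
  assumes "L \<subseteq> node_pairs n"
  shows "degree_free L T \<longleftrightarrow> L \<inter> {e \<in> node_pairs n. e \<inter> T \<noteq> {}} = {}"
proof -
  have "finite L" using assms finite_node_pairs finite_subset by blast
  then show ?thesis using assms by (auto simp: degree_free_def long_degree_def)
qed

lemma prob_no_gap:
  assumes p: "p = 2 * real n powr (- \<alpha>)" "p \<le> 1 / 2" and W: "0 < W" "W \<le> n"
  shows "measure_pmf.prob (M3 \<alpha> n) {L. \<forall>k<n div W. \<not> degree_free L {k * W..<k * W + W}}
    \<le> exp (2 * p * W * n) / (n div W) + (exp (2 * p * W\<^sup>2) - 1)"
proof -
  define N where "N = n div W"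
  define T where "T k = {k * W..<k * W + W}" for k
  define B where "B k = {e \<in> node_pairs n. e \<inter> T k \<noteq> {}}" for k
  define A where "A k = {L. L \<inter> B k = {}}" for k
  let ?P = "measure_pmf.prob (M3 \<alpha> n)"
  have finB: "finite (B k)" for k using finite_node_pairs by (simp add: B_def)
  have q: "exp (- (2 * p)) \<le> 1 - p" "0 < 1 - p" "0 \<le> p"
  proof -
    show "0 \<le> p" "0 < 1 - p" using p by auto
    have "- (2 * p) \<le> ln (1 - p)"
    proof -
      have "p * p \<le> 1 / 2 * p" using p by (intro mult_right_mono) auto
      then show ?thesis
        using ln_one_minus_pos_lower_bound[of p] p by (simp add: power2_eq_square)
    qed
    then show "exp (- (2 * p)) \<le> 1 - p" using \<open>0 < 1 - p\<close> by (simp add: ln_ge_iff)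
  qed
  have N: "0 < N" using W by (simp add: N_def div_greater_zero_iff)
  have Tn: "T k \<subseteq> {..<n}" if "k < N" for k
  proof -
    have "(k + 1) * W \<le> N * W" using that by (intro mult_le_mono1) simp
    also have "\<dots> \<le> n" by (simp add: N_def)
    finally show ?thesis by (auto simp: T_def)
  qed
  have cB: "card (B k) \<le> W * n" if "k < N" for k
  proof -
    have "B k \<subseteq> (\<lambda>(i, j). {i, j}) ` (T k \<times> {..<n})"
    proof
      fix e assume "e \<in> B k"
      then obtain i j where "e = {i, j}" "i \<in> T k" "j < n"
        by (auto simp: B_def node_pairs_def card_2_iff)
      then show "e \<in> (\<lambda>(i, j). {i, j}) ` (T k \<times> {..<n})" by auto
    qed
    then have "card (B k) \<le> card (T k \<times> {..<n})" by (rule surj_card_le[rotated]) (auto simp: T_def)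
    then show ?thesis by (simp add: T_def)
  qed
  have disj: "T j \<inter> T k = {}" if "j \<noteq> k" for j k
  proof -
    have "x div W = k" if "x \<in> T k" for x k
      using that W by (intro div_nat_eqI) (auto simp: T_def algebra_simps)
    then show ?thesis using that by blast
  qed
  have cBB: "card (B j \<inter> B k) \<le> W\<^sup>2" if "j \<noteq> k" for j k
  proof -
    have "B j \<inter> B k \<subseteq> (\<lambda>(i, j). {i, j}) ` (T j \<times> T k)"
    proof
      fix e assume e: "e \<in> B j \<inter> B k"
      then obtain x y where xy: "x \<in> e" "x \<in> T j" "y \<in> e" "y \<in> T k" by (auto simp: B_def)
      then have "x \<noteq> y" using disj[OF that] by auto
      have "e = {x, y}"
        using e xy \<open>x \<noteq> y\<close> by (auto simp: B_def node_pairs_def card_2_iff)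
      then show "e \<in> (\<lambda>(i, j). {i, j}) ` (T j \<times> T k)" using xy by auto
    qed
    then have "card (B j \<inter> B k) \<le> card (T j \<times> T k)" by (rule surj_card_le[rotated]) (auto simp: T_def)
    then show ?thesis by (simp add: T_def power2_eq_square)
  qed
  have BP: "B k \<subseteq> node_pairs n" for k by (auto simp: B_def)
  have PA: "?P (A k) = (1 - p) ^ card (B k)" for k
    unfolding A_def using p by (intro prob_M3_avoid BP) auto
  have PA2: "?P (A j \<inter> A k) = (1 - p) ^ card (B j \<union> B k)" for j k
  proof -
    have "A j \<inter> A k = {L. L \<inter> (B j \<union> B k) = {}}" by (auto simp: A_def)
    then show ?thesis using p BP by (simp add: prob_M3_avoid)
  qed
  have "?P {L. \<forall>k\<in>{..<N}. L \<notin> A k} \<le> 1 / (\<Sum>k<N. ?P (A k)) + (exp (2 * p * W\<^sup>2) - 1)"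
  proof (rule second_moment)
    show "0 < (\<Sum>k<N. ?P (A k))" using N q by (auto simp: PA intro!: sum_pos)
    fix j k :: nat assume "j \<noteq> k"
    have "card (B j \<union> B k) + card (B j \<inter> B k) = card (B j) + card (B k)"
      using card_Un_Int[OF finB finB] by simp
    then have "(1 - p) ^ card (B j) * (1 - p) ^ card (B k)
        = (1 - p) ^ card (B j \<union> B k) * (1 - p) ^ card (B j \<inter> B k)"
      by (simp add: power_add[symmetric])
    also have "\<dots> \<ge> (1 - p) ^ card (B j \<union> B k) * exp (- (2 * p * W\<^sup>2))"
    proof (intro mult_left_mono)
      have "exp (- (2 * p * W\<^sup>2)) = exp (- (2 * p)) ^ W\<^sup>2"
        by (simp add: exp_of_nat_mult[symmetric] mult.commute)
      also have "\<dots> \<le> (1 - p) ^ W\<^sup>2" using q by (intro power_mono) auto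
      also have "\<dots> \<le> (1 - p) ^ card (B j \<inter> B k)"
        using q cBB[OF \<open>j \<noteq> k\<close>] by (intro power_decreasing) auto
      finally show "exp (- (2 * p * W\<^sup>2)) \<le> (1 - p) ^ card (B j \<inter> B k)" .
    qed (use q in auto)
    finally show "?P (A j \<inter> A k) \<le> (1 + (exp (2 * p * W\<^sup>2) - 1)) * ?P (A j) * ?P (A k)"
      by (simp add: PA PA2 exp_minus field_simps)
  qed (use q in auto)
  also have "1 / (\<Sum>k<N. ?P (A k)) \<le> exp (2 * p * W * n) / N"
  proof -
    have "exp (- (2 * p * W * n)) \<le> ?P (A k)" if "k < N" for k
    proof -
      have "exp (- (2 * p * W * n)) = exp (- (2 * p)) ^ (W * n)"
        by (simp add: exp_of_nat_mult[symmetric] mult.commute mult.left_commute)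
      also have "\<dots> \<le> (1 - p) ^ (W * n)" using q by (intro power_mono) auto
      also have "\<dots> \<le> (1 - p) ^ card (B k)" using q cB[OF that] by (intro power_decreasing) auto
      finally show ?thesis by (simp add: PA)
    qed
    then have "(\<Sum>k<N. exp (- (2 * p * W * n))) \<le> (\<Sum>k<N. ?P (A k))" by (intro sum_mono) auto
    then have "N * exp (- (2 * p * W * n)) \<le> (\<Sum>k<N. ?P (A k))" by simp
    then have "1 / (\<Sum>k<N. ?P (A k)) \<le> 1 / (N * exp (- (2 * p * W * n)))"
      using N by (intro divide_left_mono mult_pos_pos) (auto intro: less_le_trans[rotated])
    then show ?thesis by (simp add: exp_minus field_simps)
  qed
  also have "?P {L. \<forall>k\<in>{..<N}. L \<notin> A k} = ?P {L. \<forall>k<N. \<not> degree_free L (T k)}"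
    using set_pmf_M3[of \<alpha> n] degree_free_iff[of _ n]
    by (intro measure_pmf.finite_measure_eq_AE) (auto simp: AE_measure_pmf_iff A_def B_def)
  finally show ?thesis by (simp add: N_def T_def)
qed

lemma prob_busy_window:
  assumes p: "p = 2 * real n powr (- \<alpha>)" "p \<le> 1" and w: "w \<le> n"
  shows "measure_pmf.prob (M3 \<alpha> n) {L. \<exists>x<n. \<forall>s<w. long_degree L ((x + s) mod n) \<noteq> 0}
    \<le> n * (w\<^sup>2 * p + (n * p) ^ w)"
proof -
  let ?P = "measure_pmf.prob (M3 \<alpha> n)"
  define T where "T x = (\<lambda>s. (x + s) mod n) ` {..<w}" for x
  define inside where "inside x = (\<Union>e\<in>{e. e \<subseteq> T x \<and> card e = 2}. {L. {e} \<subseteq> L})" for x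
  define outside where "outside x = (\<Union>\<phi>\<in>T x \<rightarrow>\<^sub>E ({..<n} - T x). {L. (\<lambda>t. {t, \<phi> t}) ` T x \<subseteq> L})" for x
  have "0 \<le> p" using p by simp
  have Tn: "T x \<subseteq> {..<n}" if "x < n" for x using that by (auto simp: T_def)
  have finT: "finite (T x)" for x by (simp add: T_def)
  have cT: "card (T x) = w" for x
  proof -
    have "t \<le> s" if "s < w" "t < w" "(x + s) mod n = (x + t) mod n" for s t
    proof (rule ccontr)
      assume "\<not> t \<le> s"
      then have "n dvd t - s" using that(3) mod_eq_dvd_iff_nat[of "x + s" "x + t" n] by simp
      then show False using \<open>\<not> t \<le> s\<close> that(2) w by (auto dest!: dvd_imp_le)
    qed
    then have "inj_on (\<lambda>s. (x + s) mod n) {..<w}" by (intro inj_onI antisym) auto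
    then show ?thesis by (simp add: T_def card_image)
  qed
  have inside_le: "?P (inside x) \<le> w\<^sup>2 * p" if "x < n" for x
  proof -
    let ?E = "{e. e \<subseteq> T x \<and> card e = 2}"
    have fin: "finite ?E" using finT by (auto intro: finite_subset[of _ "Pow (T x)"])
    have "card ?E = w choose 2" using n_subsets[OF finT[of x], of 2] by (simp add: cT)
    also have "\<dots> \<le> w * (w - 1)" by (simp add: choose_two)
    also have "\<dots> \<le> w\<^sup>2" by (simp add: power2_eq_square)
    finally have "real (card ?E) \<le> w\<^sup>2" by (simp only: of_nat_le_iff)
    have "?P (inside x) \<le> (\<Sum>e\<in>?E. ?P {L. {e} \<subseteq> L})"
      unfolding inside_def using fin by (intro measure_pmf.finite_measure_subadditive_finite) auto
    also have "\<dots> = (\<Sum>e\<in>?E. p)"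
      using Tn[OF that] by (intro sum.cong refl) (subst prob_M3_contain[OF p]; auto simp: node_pairs_def)
    also have "\<dots> \<le> w\<^sup>2 * p" using \<open>real (card ?E) \<le> w\<^sup>2\<close> \<open>0 \<le> p\<close> by (simp add: mult_right_mono)
    finally show ?thesis .
  qed
  have outside_le: "?P (outside x) \<le> (n * p) ^ w" if "x < n" for x
  proof -
    let ?F = "T x \<rightarrow>\<^sub>E ({..<n} - T x)"
    have "card ?F = card ({..<n} - T x) ^ w" by (simp add: card_PiE finT cT)
    also have "\<dots> \<le> card {..<n} ^ w" by (intro power_mono card_mono) auto
    finally have "real (card ?F) \<le> real n ^ w" by (metis card_lessThan of_nat_le_iff of_nat_power)
    have "?P (outside x) \<le> (\<Sum>\<phi>\<in>?F. ?P {L. (\<lambda>t. {t, \<phi> t}) ` T x \<subseteq> L})"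
      unfolding outside_def
      by (intro measure_pmf.finite_measure_subadditive_finite finite_PiE finT) auto
    also have "\<dots> = (\<Sum>\<phi>\<in>?F. p ^ w)"
    proof (intro sum.cong refl)
      fix \<phi> assume \<phi>: "\<phi> \<in> ?F"
      then have \<phi>': "\<phi> t < n" "\<phi> t \<notin> T x" if "t \<in> T x" for t using that by (auto simp: PiE_iff)
      have "inj_on (\<lambda>t. {t, \<phi> t}) (T x)"
        using \<phi>' by (auto simp: inj_on_def doubleton_eq_iff)
      then have "card ((\<lambda>t. {t, \<phi> t}) ` T x) = w" by (simp add: card_image cT)
      moreover have "(\<lambda>t. {t, \<phi> t}) ` T x \<subseteq> node_pairs n"
      proof
        fix e assume "e \<in> (\<lambda>t. {t, \<phi> t}) ` T x"
        then obtain t where t: "t \<in> T x" "e = {t, \<phi> t}" by auto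
        have "t \<noteq> \<phi> t" using \<phi>'(2)[OF t(1)] t(1) by metis
        then show "e \<in> node_pairs n"
          using t \<phi>'[OF t(1)] Tn[OF that] by (auto simp: node_pairs_def)
      qed
      ultimately show "?P {L. (\<lambda>t. {t, \<phi> t}) ` T x \<subseteq> L} = p ^ w"
        using prob_M3_contain[OF p] by simp
    qed
    also have "\<dots> \<le> real n ^ w * p ^ w"
      using \<open>real (card ?F) \<le> real n ^ w\<close> \<open>0 \<le> p\<close> by (simp add: mult_right_mono)
    finally show ?thesis by (simp add: power_mult_distrib)
  qed
  have "?P {L. \<exists>x<n. \<forall>s<w. long_degree L ((x + s) mod n) \<noteq> 0} \<le> ?P (\<Union>x\<in>{..<n}. inside x \<union> outside x)"
  proof (rule measure_pmf.finite_measure_mono_AE)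
    have "L \<in> (\<Union>x\<in>{..<n}. inside x \<union> outside x)"
      if L: "L \<subseteq> node_pairs n" and x: "x < n" "\<forall>s<w. long_degree L ((x + s) mod n) \<noteq> 0" for L x
    proof -
      have "\<exists>y<n. y \<noteq> t \<and> {t, y} \<in> L" if t: "t \<in> T x" for t
      proof -
        obtain s where s: "s < w" "t = (x + s) mod n" using t by (auto simp: T_def)
        then have "card {e \<in> L. t \<in> e} \<noteq> 0" using x(2) unfolding long_degree_def by blast
        then have "{e \<in> L. t \<in> e} \<noteq> {}" by (metis card.empty)
        then obtain e where e: "e \<in> L" "t \<in> e" by blast
        then have "e \<subseteq> {..<n}" "card e = 2" using L by (auto simp: node_pairs_def)
        then obtain a b where "e = {a, b}" "a \<noteq> b" "a < n" "b < n" by (auto simp: card_2_iff)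
        then show ?thesis using e by (auto simp: insert_commute)
      qed
      then obtain y where y: "\<And>t. t \<in> T x \<Longrightarrow> y t < n \<and> y t \<noteq> t \<and> {t, y t} \<in> L" by metis
      show ?thesis
      proof (cases "\<exists>t\<in>T x. y t \<in> T x")
        case True
        then obtain t where "t \<in> T x" "y t \<in> T x" by auto
        then have "{t, y t} \<subseteq> T x \<and> card {t, y t} = 2" "{t, y t} \<in> L" using y[of t] by auto
        then have "L \<in> inside x" unfolding inside_def by blast
        then show ?thesis using x by auto
      next
        case False
        then have "restrict y (T x) \<in> T x \<rightarrow>\<^sub>E ({..<n} - T x)" using y by (auto simp: PiE_iff)
        moreover have "(\<lambda>t. {t, restrict y (T x) t}) ` T x \<subseteq> L" using y by auto
        ultimately have "L \<in> outside x" unfolding outside_def by blast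
        then show ?thesis using x by auto
      qed
    qed
    then show "AE L in M3 \<alpha> n. L \<in> {L. \<exists>x<n. \<forall>s<w. long_degree L ((x + s) mod n) \<noteq> 0}
        \<longrightarrow> L \<in> (\<Union>x\<in>{..<n}. inside x \<union> outside x)"
      using set_pmf_M3[of \<alpha> n] unfolding AE_measure_pmf_iff Ball_def mem_Collect_eq
      by (metis PowD subsetD)
  qed auto
  moreover have "?P (\<Union>x\<in>{..<n}. inside x \<union> outside x) \<le> (\<Sum>x<n. ?P (inside x \<union> outside x))"
    by (intro measure_pmf.finite_measure_subadditive_finite) auto
  moreover have "(\<Sum>x<n. ?P (inside x \<union> outside x)) \<le> (\<Sum>x<n. w\<^sup>2 * p + (n * p) ^ w)"
  proof (rule sum_mono)
    fix x assume "x \<in> {..<n}"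
    have "?P (inside x \<union> outside x) \<le> ?P (inside x) + ?P (outside x)"
      by (intro measure_Un_le) auto
    then show "?P (inside x \<union> outside x) \<le> w\<^sup>2 * p + (n * p) ^ w"
      using inside_le[of x] outside_le[of x] \<open>x \<in> {..<n}\<close> by simp
  qed
  ultimately show ?thesis by simp
qed

context long_range
begin

lemma gap_t_mix_lower:
  fixes U :: "real \<Rightarrow> real" and \<epsilon> :: real
  assumes gap: "degree_free L {a - H..a + H}" "H \<le> a" "a + H < n"
    and con: "l2_contraction n P c" "0 < c" "c \<le> 1"
    and U: "U 0 = 0" "\<And>x. 0 \<le> U x" "\<And>x. U x < F \<Longrightarrow> \<bar>x\<bar> < H" and "0 < F"
    and drift: "\<And>x. (q\<^sub>c + r) * U (x + 1) + (q\<^sub>c - r) * U (x - 1) \<le> 2 * q\<^sub>c * U x + 1"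
    and "\<epsilon> < 1" and H: "4 * H < (1 - \<epsilon>) * n"
  shows "ereal ((1 - \<epsilon>) / 2 * F) < ereal_of_enat (t_mix P \<epsilon>)"
proof (rule t_mix_lower)
  define f where "f i = min (U (real i - real a)) F" for i
  have dim: "dim_row P = n" by (simp add: hom_chain_def)
  show "unit_vec n a \<in> prob_vecs (dim_row P)"
    using gap by (auto simp: dim prob_vecs_def unit_vec_def)
  show "0 \<le> (1 - \<epsilon>) / 2 * F" using \<open>\<epsilon> < 1\<close> \<open>0 < F\<close> by simp
  fix k assume k: "real k \<le> (1 - \<epsilon>) / 2 * F"
  have "(\<Sum>j<n. P $$ (i, j) * f j) \<le> f i + 1" if i: "i < n" for i
  proof (cases "U (real i - real a) < F")
    case False
    have "(\<Sum>j<n. P $$ (i, j) * f j) \<le> (\<Sum>j<n. P $$ (i, j) * F)"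
      using doubly_stochastic_P i by (intro sum_mono mult_left_mono) (auto simp: f_def doubly_stochastic_def)
    also have "\<dots> = F"
      using doubly_stochastic_P i by (simp add: sum_distrib_right[symmetric] doubly_stochastic_def)
    finally show ?thesis using False by (simp add: f_def)
  next
    case True
    define x where "x = real i - real a"
    have "\<bar>x\<bar> < H" using U(3)[OF True] by (simp add: x_def)
    then have i': "a - H \<le> i" "i \<le> a + H" "0 < i" "i + 1 < n" using gap by (auto simp: x_def)
    then have deg0: "long_degree L i = 0" using gap by (auto simp: degree_free_def)
    then have "(\<Sum>j<n. of_bool ({i, j} \<in> L)) = (0 :: real)" using long_degree_eq_sum[OF L i] by simp
    then have "of_bool ({i, j} \<in> L) = (0 :: real)" if "j < n" for j
      using that by (subst (asm) sum_nonneg_eq_0_iff) auto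
    then have "(\<Sum>j<n. of_bool ({i, j} \<in> L) * f j) = 0" by (intro sum.neutral) auto
    then have "(\<Sum>j<n. P $$ (i, j) * f j) = (q\<^sub>c + r) * f (i + 1) + (q\<^sub>c - r) * f (i - 1) + (1 - 2 * q\<^sub>c) * f i"
      using i' unfolding P_sum[OF i] by (simp add: hold_def deg0)
    also have "\<dots> \<le> (q\<^sub>c + r) * U (x + 1) + (q\<^sub>c - r) * U (x - 1) + (1 - 2 * q\<^sub>c) * U x"
    proof (intro add_mono mult_left_mono)
      show "f (i + 1) \<le> U (x + 1)" "f (i - 1) \<le> U (x - 1)" "f i \<le> U x"
        using i' by (auto simp: f_def x_def of_nat_diff algebra_simps min_le_iff_disj)
    qed (use r le1 pos in auto)
    also have "\<dots> \<le> U x + 1" using drift[of x] by (simp add: algebra_simps)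
    finally show ?thesis using True by (simp add: f_def x_def)
  qed
  then have "1 - real k * 1 / F - card {i\<in>{..<n}. f i < F} / n \<le> tv_dist (evolve P k (unit_vec n a)) (uniform_vec n)"
    using gap U \<open>0 < F\<close> doubly_stochastic_P by (intro tv_lower_by_drift) (auto simp: f_def)
  moreover have "real k * 1 / F \<le> (1 - \<epsilon>) / 2" using k \<open>0 < F\<close> by (simp add: divide_le_eq)
  moreover have "card {i\<in>{..<n}. f i < F} / n < (1 - \<epsilon>) / 2"
  proof -
    have "{i\<in>{..<n}. f i < F} \<subseteq> {a - H..<a + H}"
    proof
      fix i assume "i \<in> {i\<in>{..<n}. f i < F}"
      then have "\<bar>real i - real a\<bar> < H" by (intro U(3)) (auto simp: f_def)
      then show "i \<in> {a - H..<a + H}" by auto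
    qed
    then have "card {i\<in>{..<n}. f i < F} \<le> 2 * H"
      using card_mono[of "{a - H..<a + H}" "{i\<in>{..<n}. f i < F}"] gap by simp
    then have "2 * real (card {i\<in>{..<n}. f i < F}) < (1 - \<epsilon>) * n" using H by linarith
    then show ?thesis using n by (simp add: field_simps)
  qed
  ultimately have "\<epsilon> < tv_dist (evolve P k (unit_vec n a)) (uniform_vec n)"
    unfolding diff_divide_distrib by linarith
  then show "\<epsilon> < tv_dist (evolve P k (unit_vec n a)) (stationary_dist P)"
    using stationary_dist_uniform[OF doubly_stochastic_P con] n by simp
qed

end

section \<open>Asymptotics\<close>

lemma t_mix_le_of_contraction:
  assumes P: "doubly_stochastic n P" and con: "l2_contraction n P c" and c: "0 < c" "c \<le> 1" and n: "0 < n"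
    and \<epsilon>: "0 < \<epsilon>" "\<epsilon> < 1"
  shows "ereal_of_enat (t_mix P \<epsilon>) \<le> ereal ((ln n - 2 * ln \<epsilon>) / c + 1)"
proof -
  define k where "k = nat \<lceil>(ln n - 2 * ln \<epsilon>) / c\<rceil>"
  have "0 \<le> ln n - 2 * ln \<epsilon>" using n \<epsilon> ln_ge_zero[of "real n"] ln_less_zero[of \<epsilon>] by linarith
  then have "0 \<le> (ln n - 2 * ln \<epsilon>) / c" using c by simp
  then have k: "(ln n - 2 * ln \<epsilon>) / c \<le> k" "k \<le> (ln n - 2 * ln \<epsilon>) / c + 1"
    unfolding k_def by linarith+
  have "n * (1 - c) ^ k \<le> n * exp (- c) ^ k"
    using c exp_ge_add_one_self[of "- c"] by (intro mult_left_mono power_mono) auto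
  also have "\<dots> = exp (ln n - c * k)"
    using n exp_of_nat_mult[of k "- c"] by (simp add: exp_diff exp_minus divide_inverse mult.commute)
  also have "ln n - c * k \<le> 2 * ln \<epsilon>" using k(1) c by (simp add: field_simps)
  then have "exp (ln n - c * k) \<le> exp (2 * ln \<epsilon>)" by simp
  also have "\<dots> = \<epsilon>\<^sup>2" using \<epsilon> exp_of_nat_mult[of 2 "ln \<epsilon>"] by simp
  finally have "t_mix P \<epsilon> \<le> enat k" by (intro t_mix_upper[OF P con c n \<epsilon>(1)])
  then have "ereal_of_enat (t_mix P \<epsilon>) \<le> ereal_of_enat (enat k)" by (simp only: ereal_of_enat_le_iff)
  also have "\<dots> \<le> ereal ((ln n - 2 * ln \<epsilon>) / c + 1)" using k(2) by simp
  finally show ?thesis .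
qed

lemma M3_aasI:
  assumes "eventually (\<lambda>n. measure_pmf.prob (M3 \<alpha> n) {L. \<not> Q n L} \<le> b n) at_top" and "b \<longlonglongrightarrow> 0"
  shows "M3_aas \<alpha> Q"
  unfolding M3_aas_def
proof (rule tendsto_sandwich)
  have compl: "measure_pmf.prob (M3 \<alpha> n) {L. Q n L} = 1 - measure_pmf.prob (M3 \<alpha> n) {L. \<not> Q n L}" for n
    using measure_pmf.prob_compl[of "{L. \<not> Q n L}" "M3 \<alpha> n"] by (simp add: Compl_eq Diff_eq)
  show "eventually (\<lambda>n. 1 - b n \<le> measure_pmf.prob (M3 \<alpha> n) {L. Q n L}) at_top"
    using assms(1) by eventually_elim (simp add: compl)
  show "(\<lambda>n. 1 - b n) \<longlonglongrightarrow> 1" using tendsto_diff[OF tendsto_const assms(2), of 1] by simp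
qed auto

lemma M3_aas_mono:
  assumes "M3_aas \<alpha> Q" and "eventually (\<lambda>n. \<forall>L\<subseteq>node_pairs n. Q n L \<longrightarrow> R n L) at_top"
  shows "M3_aas \<alpha> R"
  unfolding M3_aas_def
proof (rule tendsto_sandwich[where h = "\<lambda>_. 1"])
  show "eventually (\<lambda>n. measure_pmf.prob (M3 \<alpha> n) {L. Q n L} \<le> measure_pmf.prob (M3 \<alpha> n) {L. R n L}) at_top"
    using assms(2)
  proof eventually_elim
    case (elim n)
    then show ?case using set_pmf_M3[of \<alpha> n]
      by (intro measure_pmf.finite_measure_mono_AE) (auto simp: AE_measure_pmf_iff)
  qed
qed (use assms(1) in \<open>auto simp: M3_aas_def\<close>)

lemma M3_aas_conj:
  assumes "M3_aas \<alpha> Q" and "M3_aas \<alpha> R"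
  shows "M3_aas \<alpha> (\<lambda>n L. Q n L \<and> R n L)"
proof (rule M3_aasI)
  let ?P = "\<lambda>n. measure_pmf.prob (M3 \<alpha> n)"
  have compl: "?P n {L. \<not> S L} = 1 - ?P n {L. S L}" for n S
    using measure_pmf.prob_compl[of "{L. S L}" "M3 \<alpha> n"] by (simp add: Compl_eq Diff_eq)
  show "eventually (\<lambda>n. ?P n {L. \<not> (Q n L \<and> R n L)} \<le> (1 - ?P n {L. Q n L}) + (1 - ?P n {L. R n L})) at_top"
  proof (intro always_eventually allI)
    fix n
    have "{L. \<not> (Q n L \<and> R n L)} = {L. \<not> Q n L} \<union> {L. \<not> R n L}" by auto
    then have "?P n {L. \<not> (Q n L \<and> R n L)} \<le> ?P n {L. \<not> Q n L} + ?P n {L. \<not> R n L}"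
      by (simp only:) (intro measure_Un_le; simp)
    then show "?P n {L. \<not> (Q n L \<and> R n L)} \<le> (1 - ?P n {L. Q n L}) + (1 - ?P n {L. R n L})"
      by (simp only: compl)
  qed
  have "(\<lambda>n. (1 - ?P n {L. Q n L}) + (1 - ?P n {L. R n L})) \<longlonglongrightarrow> (1 - 1) + (1 - 1)"
    using assms unfolding M3_aas_def by (intro tendsto_add tendsto_diff tendsto_const)
  then show "(\<lambda>n. (1 - ?P n {L. Q n L}) + (1 - ?P n {L. R n L})) \<longlonglongrightarrow> 0" by simp
qed

definition gap_scale :: "real \<Rightarrow> nat \<Rightarrow> real" where
  "gap_scale \<alpha> n = real n powr (\<alpha> - 1) * ln (real n)"

lemma gap_scale_at_top:
  assumes "1 < \<alpha>"
  shows "filterlim (gap_scale \<alpha>) at_top at_top"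
  unfolding gap_scale_def using assms by real_asymp

lemma gap_scale_small:
  fixes c :: real
  assumes "\<alpha> < 2" "0 < c"
  shows "eventually (\<lambda>n. gap_scale \<alpha> n < c * n) at_top"
  unfolding gap_scale_def using assms by real_asymp

definition block_length :: "real \<Rightarrow> nat \<Rightarrow> nat" where
  "block_length \<alpha> n = nat \<lceil>32 * gap_scale \<alpha> n\<rceil>"

lemma block_length_bounds:
  assumes "1 \<le> gap_scale \<alpha> n"
  shows "32 * gap_scale \<alpha> n \<le> block_length \<alpha> n" "block_length \<alpha> n \<le> 33 * gap_scale \<alpha> n"
  using assms unfolding block_length_def by linarith+

lemma edge_prob_le:
  assumes "1 < \<alpha>" "0 < c"
  shows "eventually (\<lambda>n. 2 * real n powr (- \<alpha>) \<le> c) at_top"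
  using assms by real_asymp

lemma M3_aas_expanding:
  assumes \<alpha>: "1 < \<alpha>" "\<alpha> < 2"
  shows "M3_aas \<alpha> (\<lambda>n. block_expanding n (block_length \<alpha> n))"
proof (rule M3_aasI)
  show "(\<lambda>n. (exp (1 / real n) - 1) * exp (1 / real n)) \<longlonglongrightarrow> 0" by real_asymp
  have X1: "eventually (\<lambda>n. 1 \<le> gap_scale \<alpha> n) at_top"
    using gap_scale_at_top[OF \<alpha>(1)] by (simp add: filterlim_at_top)
  show "eventually (\<lambda>n. measure_pmf.prob (M3 \<alpha> n) {L. \<not> block_expanding n (block_length \<alpha> n) L}
      \<le> (exp (1 / real n) - 1) * exp (1 / real n)) at_top"
    using edge_prob_le[OF \<alpha>(1), of 1, simplified] X1 gap_scale_small[OF \<alpha>(2), of "1 / 33", simplified] eventually_gt_at_top[of 0]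
  proof eventually_elim
    case (elim n)
    define l where "l = block_length \<alpha> n"
    define p where "p = 2 * real n powr (- \<alpha>)"
    note l = block_length_bounds[OF elim(2), folded l_def]
    have "l \<le> n" "0 < l" using l elim by linarith+
    have "n \<le> 2 * (l * (n div l))"
    proof -
      have "n = l * (n div l) + n mod l" "n mod l < l" using \<open>0 < l\<close> by auto
      moreover have "l * 1 \<le> l * (n div l)"
        using \<open>0 < l\<close> \<open>l \<le> n\<close> by (intro mult_le_mono2) (simp add: div_greater_zero_iff Suc_le_eq)
      ultimately show ?thesis by linarith
    qed
    then have "real n \<le> real (2 * (l * (n div l)))" by (simp only: of_nat_le_iff)
    then have half: "real n / 2 \<le> real (l * (n div l))" by simp
    have "real n powr (1 - \<alpha>) * real n powr (\<alpha> - 1) = 1"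
      using elim by (simp add: powr_add[symmetric])
    then have "32 * ln n = real n powr (1 - \<alpha>) * real n powr (\<alpha> - 1) * (32 * ln n)" by simp
    also have "\<dots> = real n powr (1 - \<alpha>) * (32 * gap_scale \<alpha> n)"
      by (simp only: gap_scale_def mult.assoc mult.left_commute)
    also have "\<dots> \<le> real n powr (1 - \<alpha>) * l" using l by (intro mult_left_mono) auto
    also have "real n powr (1 - \<alpha>) = p * (real n / 2)"
      using elim powr_add[of "real n" 1 "- \<alpha>"] by (simp add: p_def)
    also have "p * (real n / 2) * l \<le> p * real (l * (n div l)) * l"
      using half by (intro mult_right_mono mult_left_mono) (auto simp: p_def)
    also have "\<dots> = p * real (l\<^sup>2) * (n div l)" by (simp add: power2_eq_square)
    finally have "32 * ln n \<le> p * real (l\<^sup>2) * (n div l)" .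
    then show ?case
      using prob_not_expanding[of p n \<alpha> l] \<open>0 < l\<close> \<open>l \<le> n\<close> elim(1) unfolding l_def p_def by simp
  qed
qed

definition gap_radius :: "real \<Rightarrow> nat \<Rightarrow> nat" where
  "gap_radius \<alpha> n = nat \<lfloor>(2 - \<alpha>) / 24 * gap_scale \<alpha> n\<rfloor>"

lemma M3_aas_gap:
  assumes \<alpha>: "1 < \<alpha>" "\<alpha> < 2"
  shows "M3_aas \<alpha> (\<lambda>n L. \<exists>a. gap_radius \<alpha> n \<le> a \<and> a + gap_radius \<alpha> n < n
    \<and> degree_free L {a - gap_radius \<alpha> n..a + gap_radius \<alpha> n})"
proof (rule M3_aasI)
  define c where "c = (2 - \<alpha>) / 24"
  have c: "0 < c" "12 * c + \<alpha> - 2 < 0" using \<alpha> by (auto simp: c_def field_simps)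
  define b where "b n = 6 * c * real n powr (12 * c + \<alpha> - 2) * ln n
    + (exp (36 * c\<^sup>2 * (real n powr (\<alpha> - 2) * (ln n)\<^sup>2)) - 1)" for n :: nat
  have "(\<lambda>n. 6 * c * (real n powr (12 * c + \<alpha> - 2) * ln n)) \<longlonglongrightarrow> 6 * c * 0"
    using c by (intro tendsto_mult_left) real_asymp
  moreover have "(\<lambda>n. exp (36 * c\<^sup>2 * (real n powr (\<alpha> - 2) * (ln n)\<^sup>2)) - 1) \<longlonglongrightarrow> exp (36 * c\<^sup>2 * 0) - 1"
    using \<alpha> by (intro tendsto_intros) real_asymp
  ultimately show "b \<longlonglongrightarrow> 0"
    unfolding b_def using tendsto_add by (fastforce simp: mult.assoc)
  have half: "eventually (\<lambda>n. 2 * real n powr (- \<alpha>) \<le> 1 / 2) at_top"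
    by (intro edge_prob_le \<alpha>) simp
  have small: "eventually (\<lambda>n. gap_scale \<alpha> n < 1 / (3 * c) * n) at_top"
    using c by (intro gap_scale_small \<alpha>) simp
  have X1: "eventually (\<lambda>n. 1 / c \<le> gap_scale \<alpha> n) at_top"
    using gap_scale_at_top[OF \<alpha>(1)] by (simp add: filterlim_at_top)
  show "eventually (\<lambda>n. measure_pmf.prob (M3 \<alpha> n) {L. \<not> (\<exists>a. gap_radius \<alpha> n \<le> a \<and> a + gap_radius \<alpha> n < n
    \<and> degree_free L {a - gap_radius \<alpha> n..a + gap_radius \<alpha> n})} \<le> b n) at_top"
    using half X1 small eventually_gt_at_top[of 0]
  proof eventually_elim
    case (elim n)
    define H where "H = gap_radius \<alpha> n"
    define W where "W = 2 * H + 1"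
    define X where "X = gap_scale \<alpha> n"
    define p where "p = 2 * real n powr (- \<alpha>)"
    have "1 \<le> c * X" using elim c by (simp add: X_def field_simps)
    then have W: "W \<le> 3 * (c * X)" unfolding W_def H_def gap_radius_def c_def[symmetric] X_def by linarith
    have "3 * (c * X) < n" using elim c by (simp add: X_def field_simps)
    then have "W \<le> n" using W by linarith
    have "0 < W" by (simp add: W_def)
    have "0 \<le> p" by (simp add: p_def)
    have "n \<le> 2 * (W * (n div W))"
    proof -
      have "n = W * (n div W) + n mod W" "n mod W < W" using \<open>0 < W\<close> by auto
      moreover have "W * 1 \<le> W * (n div W)"
        using \<open>0 < W\<close> \<open>W \<le> n\<close> by (intro mult_le_mono2) (simp add: div_greater_zero_iff Suc_le_eq)
      ultimately show ?thesis by linarith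
    qed
    then have "real n \<le> real (2 * (W * (n div W)))" by (simp only: of_nat_le_iff)
    then have "real n / 2 \<le> W * real (n div W)" by simp
    also have "\<dots> \<le> 3 * (c * X) * (n div W)" using W by (intro mult_right_mono) auto
    finally have N: "real n \<le> 6 * (c * X) * (n div W)" by simp
    have Npos: "0 < n div W" using \<open>0 < W\<close> \<open>W \<le> n\<close> by (simp add: div_greater_zero_iff)
    have "2 * p * W * n \<le> 2 * p * (3 * (c * X)) * n"
      using W \<open>0 \<le> p\<close> by (intro mult_right_mono mult_left_mono) auto
    also have "\<dots> = 12 * c * ln n * (real n powr (- \<alpha>) * real n powr (\<alpha> - 1) * n powr 1)"
      using elim by (simp add: p_def X_def gap_scale_def)
    also have "\<dots> = 12 * c * ln n" using elim by (simp only: powr_add[symmetric]) simp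
    finally have "exp (2 * p * W * n) \<le> exp (12 * c * ln n)" by simp
    also have "\<dots> = real n powr (12 * c)" using elim by (simp add: powr_def)
    finally have "exp (2 * p * W * n) / (n div W) \<le> real n powr (12 * c) * (6 * (c * X) / n)"
    proof -
      assume "exp (2 * p * W * n) \<le> real n powr (12 * c)"
      then have "exp (2 * p * W * n) * (1 / (n div W)) \<le> real n powr (12 * c) * (6 * (c * X) / n)"
        using N Npos elim by (intro mult_mono) (auto simp: field_simps)
      then show ?thesis by simp
    qed
    also have "\<dots> = 6 * c * (real n powr (12 * c) * real n powr (\<alpha> - 1) * real n powr (- 1)) * ln n"
      using elim by (simp add: X_def gap_scale_def powr_neg_one)
    also have "\<dots> = 6 * c * real n powr (12 * c + \<alpha> - 2) * ln n"
      by (simp only: powr_add[symmetric]) (simp add: algebra_simps)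
    finally have 1: "exp (2 * p * W * n) / (n div W) \<le> \<dots>" .
    have "2 * p * real (W\<^sup>2) \<le> 2 * p * (3 * (c * X))\<^sup>2"
      using W \<open>0 \<le> p\<close> unfolding of_nat_power by (intro mult_left_mono power_mono) auto
    also have "\<dots> = 36 * c\<^sup>2 * (real n powr (- \<alpha>) * real n powr (\<alpha> - 1) * real n powr (\<alpha> - 1) * (ln n)\<^sup>2)"
      by (simp add: p_def X_def gap_scale_def power2_eq_square)
    also have "\<dots> = 36 * c\<^sup>2 * (real n powr (\<alpha> - 2) * (ln n)\<^sup>2)"
      by (simp only: powr_add[symmetric]) (simp add: algebra_simps)
    finally have "exp (2 * p * real (W\<^sup>2)) - 1 \<le> exp (36 * c\<^sup>2 * (real n powr (\<alpha> - 2) * (ln n)\<^sup>2)) - 1" by simp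
    with 1 have "exp (2 * p * W * n) / (n div W) + (exp (2 * p * real (W\<^sup>2)) - 1) \<le> b n"
      unfolding b_def by (rule add_mono)
    moreover have "measure_pmf.prob (M3 \<alpha> n) {L. \<forall>k<n div W. \<not> degree_free L {k * W..<k * W + W}}
        \<le> exp (2 * p * W * n) / (n div W) + (exp (2 * p * real (W\<^sup>2)) - 1)"
      using elim \<open>0 < W\<close> \<open>W \<le> n\<close> by (intro prob_no_gap) (auto simp: p_def)
    moreover have "measure_pmf.prob (M3 \<alpha> n) {L. \<not> (\<exists>a. H \<le> a \<and> a + H < n \<and> degree_free L {a - H..a + H})}
       \<le> measure_pmf.prob (M3 \<alpha> n) {L. \<forall>k<n div W. \<not> degree_free L {k * W..<k * W + W}}"
    proof (intro measure_pmf.finite_measure_mono subsetI CollectI allI impI notI)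
      fix L k assume L: "L \<in> {L. \<not> (\<exists>a. H \<le> a \<and> a + H < n \<and> degree_free L {a - H..a + H})}"
        and k: "k < n div W" and free: "degree_free L {k * W..<k * W + W}"
      have "(k + 1) * W \<le> (n div W) * W" using k by (intro mult_le_mono1) simp
      also have "\<dots> \<le> n" by simp
      finally have "k * W + H + H < n" by (simp add: W_def)
      moreover have "{k * W + H - H..k * W + H + H} = {k * W..<k * W + W}" by (auto simp: W_def)
      ultimately show False using L free by (auto dest!: spec[of _ "k * W + H"])
    qed auto
    ultimately show ?case by (simp add: H_def)
  qed
qed

lemma M3_aas_no_busy_window:
  assumes \<alpha>: "1 < \<alpha>" and w: "2 \<le> (\<alpha> - 1) * w"
  shows "M3_aas \<alpha> (\<lambda>n L. \<forall>x<n. \<exists>s<w. long_degree L ((x + s) mod n) = 0)"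
proof (rule M3_aasI)
  have "(\<lambda>n. 2 * (real w)\<^sup>2 * real n powr (1 - \<alpha>) + 2 ^ w * real n powr (- 1)) \<longlonglongrightarrow> 2 * (real w)\<^sup>2 * 0 + 2 ^ w * 0"
    using \<alpha> by (intro tendsto_add tendsto_mult_left) real_asymp+
  then show "(\<lambda>n. 2 * (real w)\<^sup>2 * real n powr (1 - \<alpha>) + 2 ^ w * real n powr (- 1)) \<longlonglongrightarrow> 0" by simp
  show "eventually (\<lambda>n. measure_pmf.prob (M3 \<alpha> n) {L. \<not> (\<forall>x<n. \<exists>s<w. long_degree L ((x + s) mod n) = 0)}
      \<le> 2 * (real w)\<^sup>2 * real n powr (1 - \<alpha>) + 2 ^ w * real n powr (- 1)) at_top"
    using edge_prob_le[OF \<alpha>(1), of 1, simplified] eventually_ge_at_top[of w] eventually_gt_at_top[of 0]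
  proof eventually_elim
    case (elim n)
    define p where "p = 2 * real n powr (- \<alpha>)"
    have np: "n * p = 2 * real n powr (1 - \<alpha>)"
      using elim powr_add[of "real n" 1 "- \<alpha>"] by (simp add: p_def)
    have "measure_pmf.prob (M3 \<alpha> n) {L. \<not> (\<forall>x<n. \<exists>s<w. long_degree L ((x + s) mod n) = 0)}
      = measure_pmf.prob (M3 \<alpha> n) {L. \<exists>x<n. \<forall>s<w. long_degree L ((x + s) mod n) \<noteq> 0}" by simp
    also have "\<dots> \<le> n * ((real w)\<^sup>2 * p + (n * p) ^ w)"
      using elim by (intro prob_busy_window) (auto simp: p_def)
    also have "\<dots> = (real w)\<^sup>2 * (n * p) + n * (n * p) ^ w" by (simp add: algebra_simps)
    also have "n * (n * p) ^ w = 2 ^ w * (real n powr 1 * real n powr ((1 - \<alpha>) * w))"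
      using elim unfolding np power_mult_distrib by (simp add: powr_powr[symmetric] powr_realpow)
    also have "\<dots> = 2 ^ w * real n powr (1 + (1 - \<alpha>) * w)" by (simp only: powr_add)
    also have "\<dots> \<le> 2 ^ w * real n powr (- 1)"
      using elim w by (intro mult_left_mono powr_mono) (auto simp: algebra_simps)
    finally show ?case by (simp add: np)
  qed
qed

lemma expanding_degree_bound:
  assumes exp: "block_expanding n l L" and "2 \<le> n div l" and L: "L \<subseteq> node_pairs n"
    and deg: "\<And>i. i < n \<Longrightarrow> real (long_degree L i) \<le> d"
  shows "1 \<le> d"
proof -
  have "\<exists>i<n. \<exists>j<n. block n l i \<in> {0} \<and> block n l j \<in> {1..<n div l} \<and> {i, j} \<in> L"
    using \<open>2 \<le> n div l\<close>
    by (intro exp[unfolded block_expanding_def, rule_format, of "{0}" "{1..<n div l}"]) auto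
  then obtain i j where ij: "i < n" "{i, j} \<in> L" by auto
  have "finite L" using L finite_node_pairs finite_subset by blast
  then have "0 < long_degree L i" unfolding long_degree_def using ij by (auto simp: card_gt_0_iff)
  then show ?thesis using deg[OF ij(1)] by linarith
qed

lemma t_mix_bounds:
  fixes \<alpha> \<epsilon> d :: real
  assumes lr: "long_range n L q\<^sub>c q\<^sub>l r d" and \<epsilon>: "0 < \<epsilon>" "\<epsilon> < 1"
    and exp: "block_expanding n (block_length \<alpha> n) L" and X: "1 \<le> gap_scale \<alpha> n" "33 * gap_scale \<alpha> n < n"
    and ln: "1 \<le> ln n" "- 2 * ln \<epsilon> \<le> ln n"
    and con: "lazy_chain (hom_chain n L q\<^sub>c q\<^sub>l r d) \<or>
      r = 0 \<and> (\<forall>x<n. \<exists>s<w. long_degree L ((x + s) mod n) = 0) \<and> real w \<le> gap_scale \<alpha> n"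
  defines "q \<equiv> min q\<^sub>c q\<^sub>l"
  defines "c \<equiv> (q / (d * (32 * block_length \<alpha> n)))\<^sup>2 / 2"
  shows "l2_contraction n (hom_chain n L q\<^sub>c q\<^sub>l r d) c" "0 < c" "c \<le> 1"
    "ereal_of_enat (t_mix (hom_chain n L q\<^sub>c q\<^sub>l r d) \<epsilon>)
      < ereal ((4096 * 33\<^sup>2 / q\<^sup>2 + 2) * d\<^sup>2 * real n powr (2 * \<alpha> - 2) * ln n ^ 3)"
proof -
  interpret long_range n L q\<^sub>c q\<^sub>l r d by (rule lr)
  have \<kappa>_eq: "\<kappa> = q" by (simp add: q_def \<kappa>_def)
  note k = \<kappa>[unfolded \<kappa>_eq]
  define l where "l = block_length \<alpha> n"
  define Y where "Y = gap_scale \<alpha> n"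
  define h where "h = real (32 * l)"
  have l: "32 * Y \<le> l" "l \<le> 33 * Y" using block_length_bounds[OF X(1)] by (simp_all add: l_def Y_def)
  have "0 < l" "l \<le> n" using l X by (simp_all add: Y_def)
  have h: "0 < h" "1 \<le> h" using \<open>0 < l\<close> by (simp_all add: h_def)
  have iso: "card S \<le> h * edge_boundary S" if "S \<subseteq> {..<n}" "2 * card S \<le> n" for S
    using isoperimetry[OF exp[folded l_def] \<open>0 < l\<close> \<open>l \<le> n\<close> that] by (simp add: h_def)
  have c: "c = (q / (d * h))\<^sup>2 / 2" by (simp add: c_def h_def l_def)
  have "1 * 1 \<le> d * h" using d h by (intro mult_mono) auto
  then have "q / (d * h) \<le> 1" using k by (simp add: divide_le_eq)
  then have "(q / (d * h))\<^sup>2 \<le> 1" using k d h by (intro power_le_one) auto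
  then show c1: "c \<le> 1" by (simp add: c)
  show c0: "0 < c" using k d h by (simp add: c)
  show con': "l2_contraction n P c"
    using con
  proof
    assume "lazy_chain P"
    then show ?thesis unfolding c \<kappa>_eq[symmetric] by (intro lazy_l2_contraction iso h)
  next
    assume a: "r = 0 \<and> (\<forall>x<n. \<exists>s<w. long_degree L ((x + s) mod n) = 0) \<and> real w \<le> gap_scale \<alpha> n"
    then have "0 < w" using n by (metis gr0I less_nat_zero_code not_numeral_le_zero)
    have "w \<le> h" using a l X by (simp add: h_def Y_def)
    then have "1 * real w \<le> d * h" using d by (intro mult_mono) auto
    then have "(q / (d * h))\<^sup>2 \<le> (q / w)\<^sup>2"
      using k d h \<open>0 < w\<close> by (intro power_mono divide_left_mono mult_pos_pos) auto
    also have "\<dots> = q\<^sup>2 / (real w)\<^sup>2" by (simp add: power_divide)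
    also have "\<dots> \<le> q / (real w)\<^sup>2"
      using k by (intro divide_right_mono) (auto simp: power2_eq_square mult_le_cancel_left1)
    finally show ?thesis unfolding c \<kappa>_eq[symmetric] using a by (intro reversible_l2_contraction iso h) auto
  qed
  have Yp: "1 \<le> Y" using X by (simp add: Y_def)
  have "ereal_of_enat (t_mix P \<epsilon>) \<le> ereal ((ln n - 2 * ln \<epsilon>) / c + 1)"
    using n by (intro t_mix_le_of_contraction[OF doubly_stochastic_P con' c0 c1 _ \<epsilon>]) simp
  also have "(ln n - 2 * ln \<epsilon>) / c + 1 < (4096 * 33\<^sup>2 / q\<^sup>2 + 2) * (d\<^sup>2 * (Y\<^sup>2 * ln n))"
  proof -
    have "(ln n - 2 * ln \<epsilon>) / c \<le> (2 * ln n) / c" using ln c0 by (intro divide_right_mono) auto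
    also have "\<dots> = 4096 / q\<^sup>2 * (d\<^sup>2 * ((real l)\<^sup>2 * ln n))"
      using k d h by (simp add: c h_def field_simps power2_eq_square)
    also have "\<dots> \<le> 4096 / q\<^sup>2 * (d\<^sup>2 * ((33 * Y)\<^sup>2 * ln n))"
      using l ln by (intro mult_left_mono mult_right_mono power_mono) auto
    also have "\<dots> = 4096 * 33\<^sup>2 / q\<^sup>2 * (d\<^sup>2 * (Y\<^sup>2 * ln n))" by (simp add: power_mult_distrib)
    finally have 1: "(ln n - 2 * ln \<epsilon>) / c \<le> 4096 * 33\<^sup>2 / q\<^sup>2 * (d\<^sup>2 * (Y\<^sup>2 * ln n))" .
    have "1 * (1 * 1) \<le> d\<^sup>2 * (Y\<^sup>2 * ln n)" using d Yp ln by (intro mult_mono one_le_power) auto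
    with 1 show ?thesis unfolding distrib_right by linarith
  qed
  also have "(4096 * 33\<^sup>2 / q\<^sup>2 + 2) * (d\<^sup>2 * (Y\<^sup>2 * ln n))
      = (4096 * 33\<^sup>2 / q\<^sup>2 + 2) * d\<^sup>2 * real n powr (2 * \<alpha> - 2) * ln n ^ 3"
  proof -
    have "Y\<^sup>2 = real n powr (\<alpha> - 1) * real n powr (\<alpha> - 1) * (ln n)\<^sup>2"
      by (simp add: Y_def gap_scale_def power2_eq_square)
    also have "\<dots> = real n powr (2 * \<alpha> - 2) * (ln n)\<^sup>2"
      by (simp only: powr_add[symmetric]) (simp add: algebra_simps)
    finally show ?thesis by (simp only: power2_eq_square power3_eq_cube mult.assoc)
  qed
  finally show "ereal_of_enat (t_mix P \<epsilon>)
      < ereal ((4096 * 33\<^sup>2 / q\<^sup>2 + 2) * d\<^sup>2 * real n powr (2 * \<alpha> - 2) * ln n ^ 3)"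
    by simp
qed

lemma M3_aas_t_mix_bounds:
  fixes \<alpha> \<epsilon> q\<^sub>c q\<^sub>l r d c\<^sub>1 :: real and U F :: "real \<Rightarrow> real"
  assumes \<alpha>: "1 < \<alpha>" "\<alpha> < 2" and \<epsilon>: "0 < \<epsilon>" "\<epsilon> < 1"
    and q: "0 < q\<^sub>c" "0 < q\<^sub>l" "\<bar>r\<bar> \<le> q\<^sub>c" "2 * q\<^sub>c + q\<^sub>l \<le> 1"
    and deg: "aas_degree_bound \<alpha> d"
    and con: "r = 0 \<or> M3_aas \<alpha> (\<lambda>n L. lazy_chain (hom_chain n L q\<^sub>c q\<^sub>l r d))"
    and U: "U 0 = 0" "\<And>x. 0 \<le> U x" "\<And>x y. 0 \<le> x \<Longrightarrow> U y < F x \<Longrightarrow> \<bar>y\<bar> < x" "\<And>x. 0 < x \<Longrightarrow> 0 < F x"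
    and drift: "\<And>x. (q\<^sub>c + r) * U (x + 1) + (q\<^sub>c - r) * U (x - 1) \<le> 2 * q\<^sub>c * U x + 1"
    and F: "mono_on {0..} F"
  shows "M3_aas \<alpha> (\<lambda>n L.
    ereal ((1 - \<epsilon>) / 2 * F ((2 - \<alpha>) / 48 * gap_scale \<alpha> n)) < ereal_of_enat (t_mix (hom_chain n L q\<^sub>c q\<^sub>l r d) \<epsilon>) \<and>
    ereal_of_enat (t_mix (hom_chain n L q\<^sub>c q\<^sub>l r d) \<epsilon>)
      < ereal ((4096 * 33\<^sup>2 / (min q\<^sub>c q\<^sub>l)\<^sup>2 + 2) * d\<^sup>2 * real n powr (2 * \<alpha> - 2) * ln n ^ 3))"
proof -
  define w where "w = nat \<lceil>2 / (\<alpha> - 1)\<rceil>"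
  have "2 / (\<alpha> - 1) \<le> w" unfolding w_def by linarith
  then have w: "2 \<le> (\<alpha> - 1) * w" using \<alpha> by (simp add: field_simps)
  let ?P = "\<lambda>n L. hom_chain n L q\<^sub>c q\<^sub>l r d"
  define contract where "contract n L \<longleftrightarrow> lazy_chain (?P n L) \<or>
      r = 0 \<and> (\<forall>x<n. \<exists>s<w. long_degree L ((x + s) mod n) = 0)" for n L
  have "M3_aas \<alpha> contract"
    using con
  proof
    assume "r = 0"
    then show ?thesis
      by (intro M3_aas_mono[OF M3_aas_no_busy_window[OF \<alpha>(1) w]] always_eventually) (auto simp: contract_def)
  next
    assume "M3_aas \<alpha> (\<lambda>n L. lazy_chain (?P n L))"
    then show ?thesis by (rule M3_aas_mono) (auto simp: contract_def)
  qed
  note good = M3_aas_conj[OF M3_aas_conj[OF M3_aas_expanding[OF \<alpha>] this]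
      M3_aas_conj[OF M3_aas_gap[OF \<alpha>] deg[unfolded aas_degree_bound_def]]]
  define c where "c = (2 - \<alpha>) / 24"
  have c: "0 < c" using \<alpha> by (simp add: c_def)
  have large: "eventually (\<lambda>n. B \<le> gap_scale \<alpha> n) at_top" for B
    using gap_scale_at_top[OF \<alpha>(1)] by (simp add: filterlim_at_top)
  have ln_large: "eventually (\<lambda>n. B \<le> ln (real n)) at_top" for B by real_asymp
  have "eventually (\<lambda>n. gap_scale \<alpha> n < 1 / 66 * n) at_top" by (intro gap_scale_small \<alpha>) simp
  moreover have "eventually (\<lambda>n. gap_scale \<alpha> n < (1 - \<epsilon>) / (4 * c) * n) at_top"
    using \<epsilon> c by (intro gap_scale_small \<alpha>) simp
  ultimately have "eventually (\<lambda>n. gap_scale \<alpha> n < 1 / 66 * n \<and> gap_scale \<alpha> n < (1 - \<epsilon>) / (4 * c) * n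
      \<and> max 1 w \<le> gap_scale \<alpha> n \<and> 2 / c \<le> gap_scale \<alpha> n \<and> max 1 (- 2 * ln \<epsilon>) \<le> ln n \<and> 3 \<le> n) at_top"
    using large[of "max 1 w"] large[of "2 / c"] ln_large[of "max 1 (- 2 * ln \<epsilon>)"] eventually_ge_at_top[of 3]
    by eventually_elim blast
  then show ?thesis
  proof (rule M3_aas_mono[OF good eventually_mono])
    fix n assume elim: "gap_scale \<alpha> n < 1 / 66 * n \<and> gap_scale \<alpha> n < (1 - \<epsilon>) / (4 * c) * n
      \<and> max 1 w \<le> gap_scale \<alpha> n \<and> 2 / c \<le> gap_scale \<alpha> n \<and> max 1 (- 2 * ln \<epsilon>) \<le> ln n \<and> 3 \<le> n"
    define X where "X = gap_scale \<alpha> n"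
    define H where "H = gap_radius \<alpha> n"
    define l where "l = block_length \<alpha> n"
    have X1: "1 \<le> gap_scale \<alpha> n" "real w \<le> gap_scale \<alpha> n" using elim by auto
    note l = block_length_bounds[OF X1(1), folded l_def X_def]
    have "2 * l \<le> n" "0 < l" using l elim by (simp_all add: X_def) linarith+
    then have "2 \<le> n div l" by (simp add: less_eq_div_iff_mult_less_eq)
    have "2 \<le> c * X" using elim c by (simp add: X_def field_simps)
    then have H: "c * X / 2 \<le> H" "H \<le> c * X" "0 < H"
      unfolding H_def gap_radius_def c_def[symmetric] X_def[symmetric] by linarith+
    have "4 * (c * X) < (1 - \<epsilon>) * n" using elim c by (simp add: X_def field_simps)
    then have H4: "4 * real H < (1 - \<epsilon>) * n" using H by linarith
    have "ereal ((1 - \<epsilon>) / 2 * F ((2 - \<alpha>) / 48 * gap_scale \<alpha> n)) < ereal_of_enat (t_mix (?P n L) \<epsilon>) \<and>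
        ereal_of_enat (t_mix (?P n L) \<epsilon>)
          < ereal ((4096 * 33\<^sup>2 / (min q\<^sub>c q\<^sub>l)\<^sup>2 + 2) * d\<^sup>2 * real n powr (2 * \<alpha> - 2) * ln n ^ 3)"
      if L: "L \<subseteq> node_pairs n" and exp: "block_expanding n (block_length \<alpha> n) L"
        and contract: "contract n L" and d: "\<forall>i<n. real (long_degree L i) \<le> d"
        and a: "gap_radius \<alpha> n \<le> a" "a + gap_radius \<alpha> n < n"
          "degree_free L {a - gap_radius \<alpha> n..a + gap_radius \<alpha> n}" for L a
    proof -
      have "1 \<le> d"
        using exp \<open>2 \<le> n div l\<close> L d by (intro expanding_degree_bound[of n l L]) (auto simp: l_def)
      then have lr: "long_range n L q\<^sub>c q\<^sub>l r d"
        using elim L q d by unfold_locales auto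
      have con: "lazy_chain (?P n L) \<or>
          r = 0 \<and> (\<forall>x<n. \<exists>s<w. long_degree L ((x + s) mod n) = 0) \<and> real w \<le> gap_scale \<alpha> n"
        using contract X1 by (auto simp: contract_def)
      have "33 * gap_scale \<alpha> n < n" "1 \<le> ln n" "- 2 * ln \<epsilon> \<le> ln n" using elim by auto
      note bounds = t_mix_bounds[OF lr \<epsilon> exp X1(1) this con]
      have "ereal ((1 - \<epsilon>) / 2 * F H) < ereal_of_enat (t_mix (?P n L) \<epsilon>)"
        using a H H4 U drift \<epsilon>
        by (intro long_range.gap_t_mix_lower[OF lr _ _ _ bounds(1-3), where a = a and H = H and U = U])
          (auto simp: H_def[symmetric])
      moreover have "ereal ((1 - \<epsilon>) / 2 * F ((2 - \<alpha>) / 48 * gap_scale \<alpha> n)) \<le> ereal ((1 - \<epsilon>) / 2 * F H)"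
        using H \<epsilon> \<open>2 \<le> c * X\<close> unfolding ereal_less_eq by (intro mult_left_mono mono_onD[OF F]) (auto simp: c_def X_def)
      ultimately show ?thesis using bounds(4) by (blast intro: le_less_trans)
    qed
    then show "\<forall>L\<subseteq>node_pairs n.
        ((block_expanding n (block_length \<alpha> n) L \<and> contract n L) \<and>
         (\<exists>a. gap_radius \<alpha> n \<le> a \<and> a + gap_radius \<alpha> n < n
            \<and> degree_free L {a - gap_radius \<alpha> n..a + gap_radius \<alpha> n}) \<and>
         (\<forall>i<n. real (long_degree L i) \<le> d)) \<longrightarrow>
        ereal ((1 - \<epsilon>) / 2 * F ((2 - \<alpha>) / 48 * gap_scale \<alpha> n)) < ereal_of_enat (t_mix (?P n L) \<epsilon>) \<and>
        ereal_of_enat (t_mix (?P n L) \<epsilon>)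
          < ereal ((4096 * 33\<^sup>2 / (min q\<^sub>c q\<^sub>l)\<^sup>2 + 2) * d\<^sup>2 * real n powr (2 * \<alpha> - 2) * ln n ^ 3)"
      by blast
  qed
qed

theorem theorem24:
  fixes \<alpha> \<epsilon> q\<^sub>c q\<^sub>l r :: real
  assumes "1 < \<alpha>" and "\<alpha> < 2"
    and "0 < \<epsilon>" and "\<epsilon> < 1"
    and "0 < q\<^sub>c" and "0 < q\<^sub>l" and "\<bar>r\<bar> \<le> q\<^sub>c" and "2 * q\<^sub>c + q\<^sub>l \<le> 1"
  shows
    "(r = 0 \<longrightarrow>
       (\<exists>c\<^sub>1>0. \<exists>c\<^sub>2>0. \<forall>d. aas_degree_bound \<alpha> d \<longrightarrow>
         M3_aas \<alpha> (\<lambda>n L.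
           ereal (c\<^sub>1 * real n powr (2 * \<alpha> - 2) * ln (real n) ^ 2)
             < ereal_of_enat (t_mix (hom_chain n L q\<^sub>c q\<^sub>l r d) \<epsilon>) \<and>
           ereal_of_enat (t_mix (hom_chain n L q\<^sub>c q\<^sub>l r d) \<epsilon>)
             < ereal (c\<^sub>2 * d\<^sup>2 * real n powr (2 * \<alpha> - 2) * ln (real n) ^ 3)))) \<and>
     (r \<noteq> 0 \<longrightarrow>
       (\<exists>c\<^sub>1>0. \<exists>c\<^sub>2>0. \<forall>d. aas_degree_bound \<alpha> d \<longrightarrow>
         M3_aas \<alpha> (\<lambda>n L. lazy_chain (hom_chain n L q\<^sub>c q\<^sub>l r d)) \<longrightarrow>
         M3_aas \<alpha> (\<lambda>n L.
           ereal (c\<^sub>1 * real n powr (\<alpha> - 1) * ln (real n))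
             < ereal_of_enat (t_mix (hom_chain n L q\<^sub>c q\<^sub>l r d) \<epsilon>) \<and>
           ereal_of_enat (t_mix (hom_chain n L q\<^sub>c q\<^sub>l r d) \<epsilon>)
             < ereal (c\<^sub>2 * d\<^sup>2 * real n powr (2 * \<alpha> - 2) * ln (real n) ^ 3))))"
proof -
  define C where "C = 4096 * 33\<^sup>2 / (min q\<^sub>c q\<^sub>l)\<^sup>2 + 2"
  have C: "0 < C" unfolding C_def by (intro add_nonneg_pos) auto
  define c where "c = (2 - \<alpha>) / 48"
  have c: "0 < c" using assms by (simp add: c_def)
  note bounds = M3_aas_t_mix_bounds[OF assms(1-8), folded C_def c_def]
  have sq: "(1 - \<epsilon>) / 2 * (c * gap_scale \<alpha> n)\<^sup>2
      = (1 - \<epsilon>) / 2 * c\<^sup>2 * real n powr (2 * \<alpha> - 2) * ln (real n) ^ 2" for n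
    using powr_add[of "real n" "\<alpha> - 1" "\<alpha> - 1"]
    by (simp add: gap_scale_def power_mult_distrib power2_eq_square)
  have "M3_aas \<alpha> (\<lambda>n L.
      ereal ((1 - \<epsilon>) / 2 * c\<^sup>2 * real n powr (2 * \<alpha> - 2) * ln (real n) ^ 2)
        < ereal_of_enat (t_mix (hom_chain n L q\<^sub>c q\<^sub>l r d) \<epsilon>) \<and>
      ereal_of_enat (t_mix (hom_chain n L q\<^sub>c q\<^sub>l r d) \<epsilon>)
        < ereal (C * d\<^sup>2 * real n powr (2 * \<alpha> - 2) * ln (real n) ^ 3))"
    if "r = 0" "aas_degree_bound \<alpha> d" for d
  proof (rule bounds[where U = "\<lambda>x. x\<^sup>2" and F = "\<lambda>x. x\<^sup>2" and d = d, unfolded sq])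
    show "(q\<^sub>c + r) * (x + 1)\<^sup>2 + (q\<^sub>c - r) * (x - 1)\<^sup>2 \<le> 2 * q\<^sub>c * x\<^sup>2 + 1" for x
      using that assms by (simp add: power2_eq_square algebra_simps)
    show "\<bar>y\<bar> < x" if "0 \<le> x" "y\<^sup>2 < x\<^sup>2" for x y :: real
      using that abs_less_iff power2_less_imp_less[of "\<bar>y\<bar>" x] by simp
  qed (use that in \<open>auto simp: mono_on_def power_mono\<close>)
  moreover have "M3_aas \<alpha> (\<lambda>n L.
      ereal ((1 - \<epsilon>) / 2 * c * real n powr (\<alpha> - 1) * ln (real n))
        < ereal_of_enat (t_mix (hom_chain n L q\<^sub>c q\<^sub>l r d) \<epsilon>) \<and>
      ereal_of_enat (t_mix (hom_chain n L q\<^sub>c q\<^sub>l r d) \<epsilon>)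
        < ereal (C * d\<^sup>2 * real n powr (2 * \<alpha> - 2) * ln (real n) ^ 3))"
    if "aas_degree_bound \<alpha> d" "M3_aas \<alpha> (\<lambda>n L. lazy_chain (hom_chain n L q\<^sub>c q\<^sub>l r d))" for d
  proof -
    have "(q\<^sub>c + r) * \<bar>x + 1\<bar> + (q\<^sub>c - r) * \<bar>x - 1\<bar> \<le> 2 * q\<^sub>c * \<bar>x\<bar> + 1" for x
    proof -
      have "(q\<^sub>c + r) * \<bar>x + 1\<bar> + (q\<^sub>c - r) * \<bar>x - 1\<bar> \<le> (q\<^sub>c + r) * (\<bar>x\<bar> + 1) + (q\<^sub>c - r) * (\<bar>x\<bar> + 1)"
        using assms by (intro add_mono mult_left_mono) auto
      then show ?thesis using assms by (simp add: algebra_simps)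
    qed
    then show ?thesis
      using bounds[where U = "\<lambda>x. \<bar>x\<bar>" and F = "\<lambda>x. x" and d = d] that
      by (simp add: mono_on_def gap_scale_def mult.assoc)
  qed
  moreover have "0 < (1 - \<epsilon>) / 2 * c\<^sup>2" "0 < (1 - \<epsilon>) / 2 * c" using c assms by auto
  ultimately show ?thesis using C by blast
qed

end
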